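(* There are infinitely many mutually non-isomorphic $AC(\sigma)$ spaces with $\sigma$ a $C$-set; that is, there is an infinite family of $C$-sets such that for any two distinct members $\sigma,\tau$ of the family, $AC(\sigma)$ and $AC(\tau)$ are not isomorphic as Banach algebras.
   Context: Identify $\mathbb{C}$ with $\mathbb{R}^2$. Let $\sigma$ be a nonempty compact subset of the plane; all functions are complex-valued. Variation factor. Let $S=[x_0,x_1,\dots,x_n]$ be a finite ordered list of (not necessarily distinct) elements of $\sigma$, $n\ge 1$. For $f:\sigma\to\mathbb{C}$ put $\mathrm{cvar}(f,S)=\sum_{i=1}^n |f(x_i)-f(x_{i-1})|$. For a line $L$ in the plane, the segment from $x_i$ to $x_{i+1}$ ($0\le i\le n-1$) is a crossing segment of $S$ on $L$ if any one of the following holds: (i) $x_i$ and $x_{i+1}$ lie on strictly opposite sides of $L$; (ii) $i=0$ and $x_i\in L$; (iii) $i>0$, $x_i\in L$ and $x_{i-1}\notin L$; (iv) $i=n-1$, $x_i\notin L$ and $x_{i+1}\in L$. Let $\mathrm{vf}(S,L)$ be the number of indices $i$ giving a crossing segment of $S$ on $L$, and $\mathrm{vf}(S)=\max_L \mathrm{vf}(S,L)$ over all lines $L$. For a one-element list, $\mathrm{cvar}(f,[x_0])=0$ and $\mathrm{vf}([x_0])=1$. The spaces. $\mathrm{var}(f,\sigma)=\sup_S \mathrm{cvar}(f,S)/\mathrm{vf}(S)$, the supremum being over all finite ordered lists of elements of $\sigma$; $\|f\|_{BV(\sigma)}=\|f\|_\infty+\mathrm{var}(f,\sigma)$; $BV(\sigma)=\{f:\sigma\to\mathbb{C}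 : \|f\|_{BV(\sigma)}<\infty\}$, which is a Banach algebra under pointwise operations. $AC(\sigma)$ is the closure in $BV(\sigma)$ of the set of restrictions to $\sigma$ of complex polynomials $p(x,y)=\sum_{n,m}c_{nm}x^ny^m$ in two real variables; it is a closed subalgebra of $BV(\sigma)$. Banach algebras $\mathcal{A},\mathcal{B}$ are isomorphic (as Banach algebras) if there is a linear multiplicative bijection $\Phi:\mathcal{A}\to\mathcal{B}$ with $\Phi$ and $\Phi^{-1}$ continuous (not necessarily isometric). A $C$-set is a countably infinite compact subset of $\mathbb{C}$ with unique limit point $0$. *)

theory Defs
  imports "HOL-Analysis.Analysis"
begin

(* The plane is the type complex.  A line is given by a nonzero normal vector a and an
   offset c; every line arises in this way (from several pairs). *)

definition line :: "complex \<Rightarrow> real \<Rightarrow> complex set" where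
  "line a c = {z. a \<bullet> z = c}"

definition opposite_sides :: "complex \<Rightarrow> real \<Rightarrow> complex \<Rightarrow> complex \<Rightarrow> bool" where
  "opposite_sides a c x y \<longleftrightarrow> (a \<bullet> x < c \<and> c < a \<bullet> y) \<or> (a \<bullet> y < c \<and> c < a \<bullet> x)"

(* A list S = [x_0, ..., x_n] has length n + 1, so the last segment has index n - 1 exactly
   when Suc (Suc i) = length S. *)

definition crossing_segment :: "complex list \<Rightarrow> complex \<Rightarrow> real \<Rightarrow> nat \<Rightarrow> bool" where
  "crossing_segment S a c i \<longleftrightarrow>
     opposite_sides a c (S ! i) (S ! Suc i) \<or>
     (i = 0 \<and> S ! i \<in> line a c) \<or>
     (i > 0 \<and> S ! i \<in> line a c \<and> S ! (i - 1) \<notin> line a c) \<or>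
     (Suc (Suc i) = length S \<and> S ! i \<notin> line a c \<and> S ! Suc i \<in> line a c)"

definition vf_line :: "complex list \<Rightarrow> complex \<Rightarrow> real \<Rightarrow> nat" where
  "vf_line S a c = card {i. Suc i < length S \<and> crossing_segment S a c i}"

definition vf :: "complex list \<Rightarrow> nat" where
  "vf S = (if length S = 1 then 1 else Max {vf_line S a c |a c. a \<noteq> 0})"

definition cvar :: "(complex \<Rightarrow> complex) \<Rightarrow> complex list \<Rightarrow> real" where
  "cvar f S = (\<Sum>i<length S - 1. norm (f (S ! Suc i) - f (S ! i)))"

definition var :: "(complex \<Rightarrow> complex) \<Rightarrow> complex set \<Rightarrow> ennreal" where
  "var f \<sigma> = (SUP S\<in>{S. S \<noteq> [] \<and> set S \<subseteq> \<sigma>}. ennreal (cvar f S / real (vf S)))"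

definition BV_norm :: "complex set \<Rightarrow> (complex \<Rightarrow> complex) \<Rightarrow> ennreal" where
  "BV_norm \<sigma> f = (SUP x\<in>\<sigma>. ennreal (norm (f x))) + var f \<sigma>"

(* A function on \<sigma> is represented by its extension by 0 to the whole plane, so that the
   pointwise operations and equality of functions on \<sigma> are those of the type. *)

definition BV :: "complex set \<Rightarrow> (complex \<Rightarrow> complex) set" where
  "BV \<sigma> = {f. (\<forall>x. x \<notin> \<sigma> \<longrightarrow> f x = 0) \<and> BV_norm \<sigma> f < \<infinity>}"

definition BV_dist :: "complex set \<Rightarrow> (complex \<Rightarrow> complex) \<Rightarrow> (complex \<Rightarrow> complex) \<Rightarrow> real" where
  "BV_dist \<sigma> f g = enn2real (BV_norm \<sigma> (\<lambda>z. f z - g z))"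

definition polynomials_on :: "complex set \<Rightarrow> (complex \<Rightarrow> complex) set" where
  "polynomials_on \<sigma> =
     {(\<lambda>z. if z \<in> \<sigma>
           then \<Sum>n\<le>N. \<Sum>m\<le>N. b n m * of_real (Re z) ^ n * of_real (Im z) ^ m else 0)
      |(N::nat) (b :: nat \<Rightarrow> nat \<Rightarrow> complex). True}"

definition AC :: "complex set \<Rightarrow> (complex \<Rightarrow> complex) set" where
  "AC \<sigma> = Metric_space.mtopology (BV \<sigma>) (BV_dist \<sigma>) closure_of polynomials_on \<sigma>"

definition AC_topology :: "complex set \<Rightarrow> (complex \<Rightarrow> complex) topology" where
  "AC_topology \<sigma> = Metric_space.mtopology (AC \<sigma>) (BV_dist \<sigma>)"

definition AC_isomorphism ::
  "complex set \<Rightarrow> complex set \<Rightarrow> ((complex \<Rightarrow> complex) \<Rightarrow> (complex \<Rightarrow> complex)) \<Rightarrow> bool" where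
  "AC_isomorphism \<sigma> \<tau> \<Phi> \<longleftrightarrow>
     bij_betw \<Phi> (AC \<sigma>) (AC \<tau>) \<and>
     (\<forall>f\<in>AC \<sigma>. \<forall>g\<in>AC \<sigma>. \<Phi> (\<lambda>z. f z + g z) = (\<lambda>z. \<Phi> f z + \<Phi> g z)) \<and>
     (\<forall>k::complex. \<forall>f\<in>AC \<sigma>. \<Phi> (\<lambda>z. k * f z) = (\<lambda>z. k * \<Phi> f z)) \<and>
     (\<forall>f\<in>AC \<sigma>. \<forall>g\<in>AC \<sigma>. \<Phi> (\<lambda>z. f z * g z) = (\<lambda>z. \<Phi> f z * \<Phi> g z)) \<and>
     continuous_map (AC_topology \<sigma>) (AC_topology \<tau>) \<Phi> \<and>
     continuous_map (AC_topology \<tau>) (AC_topology \<sigma>) (inv_into (AC \<sigma>) \<Phi>)"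

definition AC_isomorphic :: "complex set \<Rightarrow> complex set \<Rightarrow> bool" where
  "AC_isomorphic \<sigma> \<tau> \<longleftrightarrow> (\<exists>\<Phi>. AC_isomorphism \<sigma> \<tau> \<Phi>)"

definition C_set :: "complex set \<Rightarrow> bool" where
  "C_set \<sigma> \<longleftrightarrow> countable \<sigma> \<and> infinite \<sigma> \<and> compact \<sigma> \<and> {z. z islimpt \<sigma>} = {0}"


(* The maximum in vf is over a finite nonempty set. *)

lemma finite_vf_line: "finite {vf_line S a c |a c. a \<noteq> 0}"
proof -
  have "vf_line S a c \<le> card {..<length S}" for a c
    unfolding vf_line_def by (rule card_mono) auto
  then have "{vf_line S a c |a c. a \<noteq> 0} \<subseteq> {..length S}" by auto
  then show ?thesis by (rule finite_subset) simp
qed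

lemma nonempty_vf_line: "{vf_line S a c |a c. a \<noteq> 0} \<noteq> {}"
  using zero_neq_one[where 'a=complex] by blast

(* BV_dist is a metric, so the topologies used above are the norm topologies. *)

lemma cvar_nonneg: "cvar f S \<ge> 0"
  unfolding cvar_def by (simp add: sum_nonneg)

lemma BV_norm_minus_commute: "BV_norm \<sigma> (\<lambda>z. f z - g z) = BV_norm \<sigma> (\<lambda>z. g z - f z)"
proof -
  have "norm (f x - g x - (f y - g y)) = norm (g x - f x - (g y - f y))" for x y
    using norm_minus_commute[of "f x - g x" "f y - g y"] by (simp add: algebra_simps)
  then show ?thesis
    unfolding BV_norm_def var_def cvar_def by (simp add: norm_minus_commute)
qed

lemma BV_norm_triangle: "BV_norm \<sigma> (\<lambda>z. f z + g z) \<le> BV_norm \<sigma> f + BV_norm \<sigma> g"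
proof -
  have "ennreal (norm (f x + g x)) \<le>
      (SUP x\<in>\<sigma>. ennreal (norm (f x))) + (SUP x\<in>\<sigma>. ennreal (norm (g x)))" if "x \<in> \<sigma>" for x
  proof -
    have "ennreal (norm (f x + g x)) \<le> ennreal (norm (f x)) + ennreal (norm (g x))"
      using ennreal_leI[OF norm_triangle_ineq[of "f x" "g x"]] by simp
    also have "\<dots> \<le> (SUP x\<in>\<sigma>. ennreal (norm (f x))) + (SUP x\<in>\<sigma>. ennreal (norm (g x)))"
      using that by (intro add_mono SUP_upper)
    finally show ?thesis .
  qed
  then have 1: "(SUP x\<in>\<sigma>. ennreal (norm (f x + g x))) \<le>
      (SUP x\<in>\<sigma>. ennreal (norm (f x))) + (SUP x\<in>\<sigma>. ennreal (norm (g x)))"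
    by (rule SUP_least)
  have "ennreal (cvar (\<lambda>z. f z + g z) S / real (vf S)) \<le> var f \<sigma> + var g \<sigma>"
    if S: "S \<in> {S. S \<noteq> [] \<and> set S \<subseteq> \<sigma>}" for S
  proof -
    have "cvar (\<lambda>z. f z + g z) S \<le> cvar f S + cvar g S"
      unfolding cvar_def sum.distrib[symmetric]
      by (intro sum_mono) (metis add_diff_add norm_triangle_ineq)
    then have "cvar (\<lambda>z. f z + g z) S / real (vf S) \<le> cvar f S / real (vf S) + cvar g S / real (vf S)"
      by (simp add: add_divide_distrib[symmetric] divide_right_mono)
    from ennreal_leI[OF this]
    have "ennreal (cvar (\<lambda>z. f z + g z) S / real (vf S)) \<le>
        ennreal (cvar f S / real (vf S)) + ennreal (cvar g S / real (vf S))"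
      by (simp add: cvar_nonneg)
    also have "\<dots> \<le> var f \<sigma> + var g \<sigma>"
      unfolding var_def using S by (intro add_mono SUP_upper)
    finally show ?thesis .
  qed
  then have 2: "var (\<lambda>z. f z + g z) \<sigma> \<le> var f \<sigma> + var g \<sigma>"
    unfolding var_def[of "\<lambda>z. f z + g z"] by (rule SUP_least)
  from add_mono[OF 1 2] show ?thesis
    unfolding BV_norm_def by (simp add: ac_simps)
qed

lemma BV_norm_diff_finite:
  assumes "f \<in> BV \<sigma>" "g \<in> BV \<sigma>"
  shows "BV_norm \<sigma> (\<lambda>z. f z - g z) < \<infinity>"
proof -
  have "BV_norm \<sigma> (\<lambda>z. f z - g z) \<le> BV_norm \<sigma> f + BV_norm \<sigma> (\<lambda>z. 0 - g z)"
    using BV_norm_triangle[of \<sigma> f "\<lambda>z. 0 - g z"] by simp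
  also have "\<dots> = BV_norm \<sigma> f + BV_norm \<sigma> g"
    using BV_norm_minus_commute[of \<sigma> "\<lambda>z. 0" g] by simp
  also have "\<dots> < \<infinity>" using assms by (simp add: BV_def)
  finally show ?thesis .
qed

lemma Metric_space_BV: "Metric_space (BV \<sigma>) (BV_dist \<sigma>)"
proof
  show "0 \<le> BV_dist \<sigma> f g" for f g by (simp add: BV_dist_def)
  show "BV_dist \<sigma> f g = BV_dist \<sigma> g f" for f g
    unfolding BV_dist_def by (subst BV_norm_minus_commute) (rule refl)
  show "BV_dist \<sigma> f g = 0 \<longleftrightarrow> f = g" if fg: "f \<in> BV \<sigma>" "g \<in> BV \<sigma>" for f g
  proof
    assume "f = g"
    then show "BV_dist \<sigma> f g = 0"
      by (simp add: BV_dist_def BV_norm_def var_def cvar_def SUP_constant bot_ennreal)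
  next
    assume "BV_dist \<sigma> f g = 0"
    then have "BV_norm \<sigma> (\<lambda>z. f z - g z) = 0"
      using BV_norm_diff_finite[OF fg] by (auto simp: BV_dist_def enn2real_eq_0_iff)
    then have 0: "(SUP x\<in>\<sigma>. ennreal (norm (f x - g x))) = 0"
      by (simp add: BV_norm_def)
    have "f x = g x" if "x \<in> \<sigma>" for x
    proof -
      have "ennreal (norm (f x - g x)) \<le> 0"
        unfolding 0[symmetric] using that by (rule SUP_upper)
      then show ?thesis by simp
    qed
    moreover have "f x = g x" if "x \<notin> \<sigma>" for x using that fg by (simp add: BV_def)
    ultimately show "f = g" by blast
  qed
  show "BV_dist \<sigma> f h \<le> BV_dist \<sigma> f g + BV_dist \<sigma> g h"
    if "f \<in> BV \<sigma>" "g \<in> BV \<sigma>" "h \<in> BV \<sigma>" for f g h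
  proof -
    have fin: "BV_norm \<sigma> (\<lambda>z. f z - g z) < top" "BV_norm \<sigma> (\<lambda>z. g z - h z) < top"
      using BV_norm_diff_finite that by auto
    have "BV_norm \<sigma> (\<lambda>z. f z - h z) \<le> BV_norm \<sigma> (\<lambda>z. f z - g z) + BV_norm \<sigma> (\<lambda>z. g z - h z)"
      using BV_norm_triangle[of \<sigma> "\<lambda>z. f z - g z" "\<lambda>z. g z - h z"] by simp
    then show ?thesis
      unfolding BV_dist_def enn2real_plus[OF fin, symmetric]
      using fin by (intro enn2real_mono) auto
  qed
qed

lemma AC_subset_BV: "AC \<sigma> \<subseteq> BV \<sigma>"
  unfolding AC_def
  using closure_of_subset_topspace Metric_space.topspace_mtopology[OF Metric_space_BV] by metis

lemma Metric_space_AC: "Metric_space (AC \<sigma>) (BV_dist \<sigma>)"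
  using Metric_space.subspace[OF Metric_space_BV AC_subset_BV] .

end

theory Submission
  imports Defs
begin

text \<open>The family consists of sets \<open>ray_set k\<close> with \<open>k \<ge> 1\<close>: the origin together with, on each of \<open>k\<close>
rays, a sequence of points that tends to the origin.  The Banach algebra \<open>AC (ray_set k)\<close>
determines \<open>k\<close>, and its idempotents are enough to see this.

On the one hand, the indicator function of the first \<open>n\<close> points of one ray belongs to \<open>AC\<close>, and
its norm is at most 4 for all \<open>n\<close> (\<open>AC_ray_head\<close>).  It is a product of two steps, each of which
depends on a single linear coordinate \<open>a \<bullet> z\<close>.  The variation of such a function is bounded by
the integral of the absolute value of its derivative, because the lines \<open>a \<bullet> z = c\<close> count how
often a list crosses each level \<open>c\<close> (\<open>cvar_ridge_le\<close>); with the Weierstrass theorem, applied to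
the derivative, the same bound shows that these functions are limits of polynomials
(\<open>AC_ridge\<close>).

On the other hand, a list that runs along a ray in one direction crosses every line at most once
(\<open>vf_ray_le_1\<close>), so an indicator function of bounded norm cannot change its value often along a
ray.

An isomorphism maps the indicator functions of growing pieces of \<open>k\<close> different rays to uniformly
bounded idempotents.  Their supports are disjoint for different rays, and for each ray they
exhaust an infinite set.  If the target had fewer than \<open>k\<close> rays, two of these infinite sets would
meet one ray infinitely often, and a list alternating between them would violate the uniform
bound (\<open>AC_embedding_ray_count_le\<close>).\<close>

section \<open>Variation factor and norm\<close>

lemma vf_line_le_vf: "a \<noteq> 0 \<Longrightarrow> length S \<noteq> 1 \<Longrightarrow> vf_line S a c \<le> vf S"
  unfolding vf_def using finite_vf_line[of S] by (auto intro!: Max_ge)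

lemma finite_crossings: "finite {i. Suc i < length S \<and> crossing_segment S a c i}"
  by (rule finite_subset[of _ "{..<length S}"]) auto

text \<open>A line through the first point of \<open>S\<close> already has a crossing segment, so division by
\<open>vf S\<close> in the definition of the variation is never division by zero.\<close>
lemma vf_ge_1:
  assumes "S \<noteq> []"
  shows "1 \<le> vf S"
proof (cases "length S = 1")
  case False
  with assms have "1 < length S" by (cases S) auto
  then have "{0} \<subseteq> {i. Suc i < length S \<and> crossing_segment S 1 (1 \<bullet> (S ! 0)) i}"
    by (auto simp: crossing_segment_def line_def)
  then have "card {0::nat} \<le> vf_line S 1 (1 \<bullet> (S ! 0))"
    unfolding vf_line_def
    by (intro card_mono finite_crossings)
  also have "\<dots> \<le> vf S" using False by (intro vf_line_le_vf) auto
  finally show ?thesis by simp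
qed (simp add: vf_def)

lemma BV_norm_le:
  assumes "\<And>x. x \<in> \<sigma> \<Longrightarrow> norm (f x) \<le> M"
    and "\<And>S. S \<noteq> [] \<Longrightarrow> set S \<subseteq> \<sigma> \<Longrightarrow> cvar f S \<le> V * real (vf S)"
    and "0 \<le> M" "0 \<le> V"
  shows "BV_norm \<sigma> f \<le> ennreal (M + V)"
proof -
  have "cvar f S / real (vf S) \<le> V" if "S \<noteq> []" "set S \<subseteq> \<sigma>" for S
    using assms(2)[OF that] vf_ge_1[OF that(1)] by (simp add: pos_divide_le_eq)
  then have "var f \<sigma> \<le> ennreal V"
    unfolding var_def by (auto intro!: SUP_least ennreal_leI)
  moreover have "(SUP x\<in>\<sigma>. ennreal (norm (f x))) \<le> ennreal M"
    using assms(1) by (auto intro!: SUP_least ennreal_leI)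
  ultimately show ?thesis
    unfolding BV_norm_def using assms(3,4) by (simp add: add_mono)
qed

text \<open>For functions of bounded variation this is the norm.  For all others it is the default value
that \<open>enn2real\<close> gives to infinity, so statements about it come with membership in
\<open>BV\<close>.\<close>
definition bv_norm :: "complex set \<Rightarrow> (complex \<Rightarrow> complex) \<Rightarrow> real" where
  "bv_norm \<sigma> f = enn2real (BV_norm \<sigma> f)"

lemma BV_dist_eq: "BV_dist \<sigma> f g = bv_norm \<sigma> (\<lambda>z. f z - g z)"
  by (simp add: BV_dist_def bv_norm_def)

lemma bv_norm_nonneg: "0 \<le> bv_norm \<sigma> f"
  by (simp add: bv_norm_def)

lemma BV_I:
  assumes "\<And>x. x \<in> \<sigma> \<Longrightarrow> norm (f x) \<le> M"
    and "\<And>S. S \<noteq> [] \<Longrightarrow> set S \<subseteq> \<sigma> \<Longrightarrow> cvar f S \<le> V * real (vf S)"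
    and "0 \<le> M" "0 \<le> V" "\<And>x. x \<notin> \<sigma> \<Longrightarrow> f x = 0"
  shows "f \<in> BV \<sigma>" and "bv_norm \<sigma> f \<le> M + V"
proof -
  note * = BV_norm_le[OF assms(1,2,3,4)]
  show "f \<in> BV \<sigma>"
    using assms(5) le_less_trans[OF *] by (auto simp: BV_def)
  show "bv_norm \<sigma> f \<le> M + V"
    unfolding bv_norm_def using * assms(3,4) by (intro enn2real_leI) auto
qed

lemma BV_E:
  assumes "f \<in> BV \<sigma>"
  obtains M V where "0 \<le> M" "0 \<le> V" "bv_norm \<sigma> f = M + V"
    "\<And>x. x \<in> \<sigma> \<Longrightarrow> norm (f x) \<le> M"
    "\<And>S. S \<noteq> [] \<Longrightarrow> set S \<subseteq> \<sigma> \<Longrightarrow> cvar f S \<le> V * real (vf S)"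
proof
  let ?s = "SUP x\<in>\<sigma>. ennreal (norm (f x))"
  have fin: "?s < top" "var f \<sigma> < top"
    using assms by (auto simp: BV_def BV_norm_def less_top)
  show "0 \<le> enn2real ?s" "0 \<le> enn2real (var f \<sigma>)" by simp_all
  show "bv_norm \<sigma> f = enn2real ?s + enn2real (var f \<sigma>)"
    unfolding bv_norm_def BV_norm_def using enn2real_plus[OF fin] .
  show "norm (f x) \<le> enn2real ?s" if "x \<in> \<sigma>" for x
  proof -
    have "enn2real (ennreal (norm (f x))) \<le> enn2real ?s"
      using that fin by (intro enn2real_mono SUP_upper) auto
    then show ?thesis by simp
  qed
  show "cvar f S \<le> enn2real (var f \<sigma>) * real (vf S)" if "S \<noteq> []" "set S \<subseteq> \<sigma>" for S
  proof -
    have "enn2real (ennreal (cvar f S / real (vf S))) \<le> enn2real (var f \<sigma>)"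
      unfolding var_def
      using that fin(2)[unfolded var_def] by (intro enn2real_mono SUP_upper) auto
    then have "cvar f S / real (vf S) \<le> enn2real (var f \<sigma>)"
      by (simp add: cvar_nonneg)
    then show ?thesis
      using vf_ge_1[OF that(1)] by (simp add: pos_divide_le_eq)
  qed
qed

lemma BV_outside: "f \<in> BV \<sigma> \<Longrightarrow> x \<notin> \<sigma> \<Longrightarrow> f x = 0"
  by (simp add: BV_def)

lemma BV_add:
  assumes "f \<in> BV \<sigma>" "g \<in> BV \<sigma>"
  shows "(\<lambda>z. f z + g z) \<in> BV \<sigma>" and "bv_norm \<sigma> (\<lambda>z. f z + g z) \<le> bv_norm \<sigma> f + bv_norm \<sigma> g"
proof -
  have fin: "BV_norm \<sigma> f < top" "BV_norm \<sigma> g < top"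
    using assms by (auto simp: BV_def)
  then show "(\<lambda>z. f z + g z) \<in> BV \<sigma>"
    using assms le_less_trans[OF BV_norm_triangle[of \<sigma> f g]] by (auto simp: BV_def)
  show "bv_norm \<sigma> (\<lambda>z. f z + g z) \<le> bv_norm \<sigma> f + bv_norm \<sigma> g"
    unfolding bv_norm_def enn2real_plus[OF fin, symmetric]
    using fin by (intro enn2real_mono BV_norm_triangle) auto
qed

lemma BV_diff:
  assumes "f \<in> BV \<sigma>" "g \<in> BV \<sigma>"
  shows "(\<lambda>z. f z - g z) \<in> BV \<sigma>"
  using assms BV_norm_diff_finite[OF assms] by (auto simp: BV_def)

text \<open>Each term of \<open>cvar (f g) S\<close> is split by the product rule, so
\<open>var (f g) \<le> \<parallel>f\<parallel>\<^sub>\<infinity> var g + \<parallel>g\<parallel>\<^sub>\<infinity> var f\<close>; the missing term of the product of the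
norms is \<open>var f var g \<ge> 0\<close>.\<close>
lemma BV_mult:
  assumes "f \<in> BV \<sigma>" "g \<in> BV \<sigma>"
  shows "(\<lambda>z. f z * g z) \<in> BV \<sigma>" and "bv_norm \<sigma> (\<lambda>z. f z * g z) \<le> bv_norm \<sigma> f * bv_norm \<sigma> g"
proof -
  from BV_E[OF assms(1)] obtain M V where f: "0 \<le> M" "0 \<le> V" "bv_norm \<sigma> f = M + V"
    "\<And>x. x \<in> \<sigma> \<Longrightarrow> norm (f x) \<le> M"
    "\<And>S. S \<noteq> [] \<Longrightarrow> set S \<subseteq> \<sigma> \<Longrightarrow> cvar f S \<le> V * real (vf S)" by blast
  from BV_E[OF assms(2)] obtain N W where g: "0 \<le> N" "0 \<le> W" "bv_norm \<sigma> g = N + W"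
    "\<And>x. x \<in> \<sigma> \<Longrightarrow> norm (g x) \<le> N"
    "\<And>S. S \<noteq> [] \<Longrightarrow> set S \<subseteq> \<sigma> \<Longrightarrow> cvar g S \<le> W * real (vf S)" by blast
  have sup: "norm (f x * g x) \<le> M * N" if "x \<in> \<sigma>" for x
    using f(1,4) g(4) that by (simp add: norm_mult mult_mono)
  have leib: "norm (f x * g x - f y * g y) \<le> M * norm (g x - g y) + N * norm (f x - f y)"
    if "x \<in> \<sigma>" "y \<in> \<sigma>" for x y
  proof -
    have "f x * g x - f y * g y = f x * (g x - g y) + (f x - f y) * g y"
      by (simp add: algebra_simps)
    then have "norm (f x * g x - f y * g y) \<le> norm (f x * (g x - g y)) + norm ((f x - f y) * g y)"
      using norm_triangle_ineq by metis
    also have "\<dots> \<le> M * norm (g x - g y) + norm (f x - f y) * N"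
      unfolding norm_mult using f(4) g(4) that by (intro add_mono mult_mono) (auto simp: f(1))
    finally show ?thesis by (simp add: mult.commute)
  qed
  have var: "cvar (\<lambda>z. f z * g z) S \<le> (M * W + N * V) * real (vf S)"
    if S: "S \<noteq> []" "set S \<subseteq> \<sigma>" for S
  proof -
    have "cvar (\<lambda>z. f z * g z) S \<le> M * cvar g S + N * cvar f S"
      unfolding cvar_def sum_distrib_left sum.distrib[symmetric]
      using S(2) by (intro sum_mono leib) (auto simp: subset_iff)
    also have "\<dots> \<le> M * (W * real (vf S)) + N * (V * real (vf S))"
      using f g S by (intro add_mono mult_left_mono) auto
    finally show ?thesis by (simp add: algebra_simps)
  qed
  have nn: "0 \<le> M * N" "0 \<le> M * W + N * V" using f g by auto
  have out: "f x * g x = 0" if "x \<notin> \<sigma>" for x using BV_outside[OF assms(1) that] by simp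
  note * = BV_I[where f = "\<lambda>z. f z * g z", OF sup var nn out]
  show "(\<lambda>z. f z * g z) \<in> BV \<sigma>" using *(1) .
  have "M * N + (M * W + N * V) \<le> (M + V) * (N + W)"
    using f g by (simp add: algebra_simps)
  then show "bv_norm \<sigma> (\<lambda>z. f z * g z) \<le> bv_norm \<sigma> f * bv_norm \<sigma> g"
    using *(2)[of \<sigma>] f(3) g(3) by simp
qed


section \<open>The algebra of absolutely continuous functions\<close>

lemma AC_iff:
  "f \<in> AC \<sigma> \<longleftrightarrow> f \<in> BV \<sigma> \<and>
     (\<forall>e>0. \<exists>p\<in>polynomials_on \<sigma>. p \<in> BV \<sigma> \<and> bv_norm \<sigma> (\<lambda>z. f z - p z) < e)"
  unfolding AC_def Metric_space.metric_closure_of[OF Metric_space_BV]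
    Metric_space.mball_def[OF Metric_space_BV] BV_dist_eq by auto

definition restr :: "complex set \<Rightarrow> (complex \<Rightarrow> complex) \<Rightarrow> complex \<Rightarrow> complex" where
  "restr \<sigma> f z = (if z \<in> \<sigma> then f z else 0)"

text \<open>Polynomials in \<open>x\<close> whose coefficients are polynomials in \<open>y\<close>: with this encoding of the
polynomials in two variables, closure under sums and products comes from the ring of
polynomials, and no double sums of coefficients have to be multiplied.\<close>
definition eval2 :: "complex poly poly \<Rightarrow> complex \<Rightarrow> complex" where
  "eval2 p z = poly (poly p [:of_real (Re z):]) (of_real (Im z))"

lemma eval2_altdef:
  assumes "degree p \<le> N" "\<And>n. n \<le> N \<Longrightarrow> degree (coeff p n) \<le> N"
  shows "eval2 p z = (\<Sum>n\<le>N. \<Sum>m\<le>N. coeff (coeff p n) m * of_real (Re z) ^ n * of_real (Im z) ^ m)"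
proof -
  have pad: "poly q x = (\<Sum>i\<le>N. coeff q i * x ^ i)" if "degree q \<le> N"
    for q :: "'a::comm_semiring_1 poly" and x
    unfolding poly_altdef using that
    by (intro sum.mono_neutral_left) (auto simp: coeff_eq_0)
  have "eval2 p z = (\<Sum>n\<le>N. poly (coeff p n) (of_real (Im z)) * of_real (Re z) ^ n)"
    unfolding eval2_def pad[OF assms(1)] by (simp add: poly_sum)
  also have "\<dots> = (\<Sum>n\<le>N. (\<Sum>m\<le>N. coeff (coeff p n) m * of_real (Im z) ^ m) * of_real (Re z) ^ n)"
    using assms(2) by (intro sum.cong refl arg_cong2[where f = "(*)"] pad) auto
  finally show ?thesis
    by (simp add: sum_distrib_left sum_distrib_right ac_simps)
qed

lemma polynomials_on_iff: "f \<in> polynomials_on \<sigma> \<longleftrightarrow> (\<exists>p. f = restr \<sigma> (eval2 p))"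
proof
  assume "f \<in> polynomials_on \<sigma>"
  then obtain N b where f: "f = (\<lambda>z. if z \<in> \<sigma>
      then \<Sum>n\<le>N. \<Sum>m\<le>N. b n m * of_real (Re z) ^ n * of_real (Im z) ^ m else 0)"
    by (auto simp: polynomials_on_def)
  define p where "p = (\<Sum>n\<le>N. monom (\<Sum>m\<le>N. monom (b n m) m) n)"
  have "eval2 p z = (\<Sum>n\<le>N. \<Sum>m\<le>N. b n m * of_real (Re z) ^ n * of_real (Im z) ^ m)" for z
    by (simp add: eval2_def p_def poly_sum poly_monom sum_distrib_left sum_distrib_right ac_simps)
  then show "\<exists>p. f = restr \<sigma> (eval2 p)"
    by (intro exI[of _ p]) (auto simp: f restr_def)
next
  assume "\<exists>p. f = restr \<sigma> (eval2 p)"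
  then obtain p where f: "f = restr \<sigma> (eval2 p)" by blast
  define N where "N = Max (insert (degree p) ((\<lambda>n. degree (coeff p n)) ` {..degree p}))"
  have deg: "degree p \<le> N" unfolding N_def by (intro Max_ge) auto
  have "degree (coeff p n) \<le> N" for n
  proof (cases "n \<le> degree p")
    case True
    then show ?thesis unfolding N_def by (intro Max_ge) auto
  qed (simp add: coeff_eq_0)
  then show "f \<in> polynomials_on \<sigma>"
    unfolding polynomials_on_def f restr_def fun_eq_iff mem_Collect_eq
    by (intro exI[of _ N] exI[of _ "\<lambda>n m. coeff (coeff p n) m"]) (auto simp: eval2_altdef[OF deg])
qed

lemma polynomials_on_const: "restr \<sigma> (\<lambda>z. k) \<in> polynomials_on \<sigma>"
  unfolding polynomials_on_iff
  by (intro exI[of _ "[:[:k:]:]"]) (simp add: fun_eq_iff restr_def eval2_def)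

lemma polynomials_on_inner: "restr \<sigma> (\<lambda>z. of_real (a \<bullet> z)) \<in> polynomials_on \<sigma>"
  unfolding polynomials_on_iff
  by (intro exI[of _ "[:[:0, of_real (Im a):], [:of_real (Re a):]:]"])
     (simp add: fun_eq_iff restr_def eval2_def inner_complex_def algebra_simps)

lemma polynomials_on_add:
  assumes "restr \<sigma> f \<in> polynomials_on \<sigma>" "restr \<sigma> g \<in> polynomials_on \<sigma>"
  shows "restr \<sigma> (\<lambda>z. f z + g z) \<in> polynomials_on \<sigma>"
proof -
  from assms obtain p q where "restr \<sigma> f = restr \<sigma> (eval2 p)" "restr \<sigma> g = restr \<sigma> (eval2 q)"
    by (auto simp: polynomials_on_iff)
  then show ?thesis
    unfolding polynomials_on_iff
    by (intro exI[of _ "p + q"]) (auto simp: fun_eq_iff restr_def eval2_def split: if_splits)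
qed

lemma polynomials_on_mult:
  assumes "restr \<sigma> f \<in> polynomials_on \<sigma>" "restr \<sigma> g \<in> polynomials_on \<sigma>"
  shows "restr \<sigma> (\<lambda>z. f z * g z) \<in> polynomials_on \<sigma>"
proof -
  from assms obtain p q where "restr \<sigma> f = restr \<sigma> (eval2 p)" "restr \<sigma> g = restr \<sigma> (eval2 q)"
    by (auto simp: polynomials_on_iff)
  then show ?thesis
    unfolding polynomials_on_iff
    by (intro exI[of _ "p * q"]) (auto simp: fun_eq_iff restr_def eval2_def split: if_splits)
qed

lemma polynomials_on_power:
  "restr \<sigma> f \<in> polynomials_on \<sigma> \<Longrightarrow> restr \<sigma> (\<lambda>z. f z ^ n) \<in> polynomials_on \<sigma>"
  by (induction n) (auto intro: polynomials_on_const polynomials_on_mult)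

lemma polynomials_on_sum:
  "(\<And>i. i \<in> I \<Longrightarrow> restr \<sigma> (f i) \<in> polynomials_on \<sigma>) \<Longrightarrow>
    restr \<sigma> (\<lambda>z. \<Sum>i\<in>I. f i z) \<in> polynomials_on \<sigma>"
  by (induction I rule: infinite_finite_induct) (auto intro: polynomials_on_const polynomials_on_add)

lemma AC_BV: "f \<in> AC \<sigma> \<Longrightarrow> f \<in> BV \<sigma>"
  by (simp add: AC_iff)

lemma polynomials_on_AC:
  assumes "p \<in> polynomials_on \<sigma>" "p \<in> BV \<sigma>"
  shows "p \<in> AC \<sigma>"
proof -
  have "p \<in> Metric_space.mtopology (BV \<sigma>) (BV_dist \<sigma>) closure_of polynomials_on \<sigma>"
    using assms closure_of_subset_Int[of "Metric_space.mtopology (BV \<sigma>) (BV_dist \<sigma>)" "polynomials_on \<sigma>"]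
    by (auto simp: Metric_space.topspace_mtopology[OF Metric_space_BV])
  then show ?thesis by (simp add: AC_def)
qed

lemma AC_const:
  shows "restr \<sigma> (\<lambda>z. k) \<in> AC \<sigma>" and "bv_norm \<sigma> (restr \<sigma> (\<lambda>z. k)) \<le> norm k"
proof -
  have c: "cvar (restr \<sigma> (\<lambda>z. k)) S \<le> 0 * real (vf S)" if "S \<noteq> []" "set S \<subseteq> \<sigma>" for S
  proof -
    have "S ! i \<in> \<sigma>" if "i < length S" for i using that \<open>set S \<subseteq> \<sigma>\<close> by auto
    then show ?thesis by (auto simp: cvar_def restr_def)
  qed
  have *: "restr \<sigma> (\<lambda>z. k) \<in> BV \<sigma>"
    by (rule BV_I(1)[OF _ c, where M = "norm k"]) (simp_all add: restr_def)
  have "bv_norm \<sigma> (restr \<sigma> (\<lambda>z. k)) \<le> norm k + 0"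
    by (rule BV_I(2)[OF _ c]) (simp_all add: restr_def)
  then show "bv_norm \<sigma> (restr \<sigma> (\<lambda>z. k)) \<le> norm k" by simp
  show "restr \<sigma> (\<lambda>z. k) \<in> AC \<sigma>" using polynomials_on_AC[OF polynomials_on_const *] .
qed

text \<open>If \<open>p\<close> and \<open>q\<close> are polynomials close to \<open>f\<close> and \<open>g\<close>, then
\<open>f g - p q = f (g - q) + (f - p) q\<close> is small, because the norm is submultiplicative and
\<open>q\<close> has norm at most \<open>\<parallel>g\<parallel> + 1\<close>.\<close>
lemma AC_mult:
  assumes "f \<in> AC \<sigma>" "g \<in> AC \<sigma>"
  shows "(\<lambda>z. f z * g z) \<in> AC \<sigma>"
  unfolding AC_iff
proof (intro conjI allI impI)
  note BV = AC_BV[OF assms(1)] AC_BV[OF assms(2)]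
  show "(\<lambda>z. f z * g z) \<in> BV \<sigma>" using BV by (rule BV_mult)
  fix e :: real assume e: "0 < e"
  define C where "C = 1 + bv_norm \<sigma> f + bv_norm \<sigma> g"
  define d where "d = min 1 (e / (2 * C))"
  have C: "1 \<le> C" "bv_norm \<sigma> f \<le> C" "bv_norm \<sigma> g + 1 \<le> C"
    using bv_norm_nonneg[of \<sigma> f] bv_norm_nonneg[of \<sigma> g] by (auto simp: C_def)
  have d: "0 < d" "d \<le> 1" "C * d \<le> e / 2"
  proof -
    show "0 < d" "d \<le> 1" using C(1) e by (auto simp: d_def)
    have "C * d \<le> C * (e / (2 * C))" using C(1) by (intro mult_left_mono) (auto simp: d_def)
    then show "C * d \<le> e / 2" using C(1) by simp
  qed
  obtain p where p: "p \<in> polynomials_on \<sigma>" "p \<in> BV \<sigma>" "bv_norm \<sigma> (\<lambda>z. f z - p z) < d"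
    using assms(1) d(1) by (auto simp: AC_iff)
  obtain q where q: "q \<in> polynomials_on \<sigma>" "q \<in> BV \<sigma>" "bv_norm \<sigma> (\<lambda>z. g z - q z) < d"
    using assms(2) d(1) by (auto simp: AC_iff)
  have r: "restr \<sigma> p = p" "restr \<sigma> q = q" "restr \<sigma> (\<lambda>z. p z * q z) = (\<lambda>z. p z * q z)"
    using p(2) q(2) by (auto simp: restr_def fun_eq_iff BV_outside)
  have fp: "(\<lambda>z. f z - p z) \<in> BV \<sigma>" and gq: "(\<lambda>z. g z - q z) \<in> BV \<sigma>" and qg: "(\<lambda>z. q z - g z) \<in> BV \<sigma>"
    using BV p q by (auto intro: BV_diff)
  have "bv_norm \<sigma> q \<le> bv_norm \<sigma> g + bv_norm \<sigma> (\<lambda>z. q z - g z)"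
    using BV_add(2)[OF BV(2) qg] by simp
  also have "bv_norm \<sigma> (\<lambda>z. q z - g z) = bv_norm \<sigma> (\<lambda>z. g z - q z)"
    by (simp only: bv_norm_def BV_norm_minus_commute[of \<sigma> q g])
  finally have qC: "bv_norm \<sigma> q \<le> C" using q(3) d(2) C(3) by simp
  have "(\<lambda>z. f z * g z - p z * q z) = (\<lambda>z. f z * (g z - q z) + (f z - p z) * q z)"
    by (simp add: fun_eq_iff algebra_simps)
  then have "bv_norm \<sigma> (\<lambda>z. f z * g z - p z * q z) \<le>
      bv_norm \<sigma> (\<lambda>z. f z * (g z - q z)) + bv_norm \<sigma> (\<lambda>z. (f z - p z) * q z)"
    using BV_add(2)[OF BV_mult(1)[OF BV(1) gq] BV_mult(1)[OF fp q(2)]] by simp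
  also have "\<dots> \<le> bv_norm \<sigma> f * bv_norm \<sigma> (\<lambda>z. g z - q z) + bv_norm \<sigma> (\<lambda>z. f z - p z) * bv_norm \<sigma> q"
    by (intro add_mono BV_mult(2) BV(1) gq fp q(2))
  also have "\<dots> \<le> C * bv_norm \<sigma> (\<lambda>z. g z - q z) + bv_norm \<sigma> (\<lambda>z. f z - p z) * C"
    using C qC by (intro add_mono mult_right_mono mult_left_mono bv_norm_nonneg) auto
  also have "\<dots> < C * d + d * C"
    using C(1) p(3) q(3) by (intro add_strict_mono mult_strict_left_mono mult_strict_right_mono) auto
  also have "\<dots> \<le> e" using d(3) by simp
  finally show "\<exists>p\<in>polynomials_on \<sigma>. p \<in> BV \<sigma> \<and> bv_norm \<sigma> (\<lambda>z. f z * g z - p z) < e"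
    using polynomials_on_mult[of \<sigma> p q] p(1,2) q(1,2) r BV_mult(1)[OF p(2) q(2)]
    by (intro bexI[of _ "\<lambda>z. p z * q z"]) auto
qed

lemma AC_scale:
  assumes "f \<in> AC \<sigma>"
  shows "(\<lambda>z. k * f z) \<in> AC \<sigma>" and "bv_norm \<sigma> (\<lambda>z. k * f z) \<le> norm k * bv_norm \<sigma> f"
proof -
  have *: "(\<lambda>z. k * f z) = (\<lambda>z. restr \<sigma> (\<lambda>z. k) z * f z)"
    using BV_outside[OF AC_BV[OF assms]] by (auto simp: fun_eq_iff restr_def)
  show "(\<lambda>z. k * f z) \<in> AC \<sigma>" unfolding * by (intro AC_mult AC_const assms)
  have "bv_norm \<sigma> (\<lambda>z. k * f z) \<le> bv_norm \<sigma> (restr \<sigma> (\<lambda>z. k)) * bv_norm \<sigma> f"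
    unfolding * by (intro BV_mult AC_BV AC_const assms)
  also have "\<dots> \<le> norm k * bv_norm \<sigma> f"
    by (intro mult_right_mono AC_const bv_norm_nonneg)
  finally show "bv_norm \<sigma> (\<lambda>z. k * f z) \<le> norm k * bv_norm \<sigma> f" .
qed

section \<open>Functions of one linear coordinate\<close>

text \<open>The lines \<open>a \<bullet> z = c\<close>, for varying \<open>c\<close>, detect the variation of \<open>z \<mapsto> f (a \<bullet> z)\<close>: the jump of
this function along one segment of \<open>S\<close> is at most the integral of \<open>\<bar>\<psi> c\<bar>\<close> over those \<open>c\<close> whose
line separates the end points of the segment.  Summing over the segments and exchanging sum and
integral, each \<open>c\<close> is counted at most \<open>vf S\<close> times.\<close>
lemma cvar_ridge_le:
  fixes f \<psi> :: "real \<Rightarrow> real"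
  assumes a: "a \<noteq> 0" and S: "\<And>z. z \<in> set S \<Longrightarrow> A \<le> a \<bullet> z \<and> a \<bullet> z \<le> B"
    and d: "\<And>t. A \<le> t \<Longrightarrow> t \<le> B \<Longrightarrow> (f has_real_derivative \<psi> t) (at t within {A..B})"
    and \<psi>: "continuous_on {A..B} \<psi>"
  shows "cvar (\<lambda>z. complex_of_real (f (a \<bullet> z))) S \<le> integral {A..B} (\<lambda>c. \<bar>\<psi> c\<bar>) * real (vf S)"
proof (cases "length S = 1")
  case True
  have "0 \<le> integral {A..B} (\<lambda>c. \<bar>\<psi> c\<bar>)"
    by (intro integral_nonneg integrable_continuous_real continuous_intros \<psi>) auto
  with True show ?thesis by (simp add: cvar_def)
next
  case False
  define n where "n = length S - 1"
  \<comment> \<open>The share of the level \<open>c\<close> in the variation along the segment \<open>i\<close>.\<close>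
  define h where "h i c = (if opposite_sides a c (S ! i) (S ! Suc i) then \<bar>\<psi> c\<bar> else 0)" for i c
  have abs_int: "(\<lambda>c. \<bar>\<psi> c\<bar>) integrable_on {s..t}" if "A \<le> s" "t \<le> B" for s t
    using that by (intro integrable_continuous_real continuous_intros continuous_on_subset[OF \<psi>]) auto
  have incr: "\<exists>J. ((\<lambda>c. if s < c \<and> c < t then \<bar>\<psi> c\<bar> else 0) has_integral J) {A..B} \<and> \<bar>f t - f s\<bar> \<le> J"
    if "A \<le> s" "s \<le> t" "t \<le> B" for s t
  proof -
    have \<psi>': "continuous_on {s..t} \<psi>" using that by (intro continuous_on_subset[OF \<psi>]) auto
    have "(\<psi> has_integral f t - f s) {s..t}"
      using that
      by (intro fundamental_theorem_of_calculus)
         (auto simp: has_real_derivative_iff_has_vector_derivative[symmetric]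
           intro!: DERIV_subset[OF d])
    then have "\<bar>f t - f s\<bar> = \<bar>integral {s..t} \<psi>\<bar>" by (simp add: integral_unique)
    also have "\<dots> \<le> integral {s..t} (\<lambda>c. \<bar>\<psi> c\<bar>)"
      using integral_norm_bound_integral[of \<psi> "{s..t}" "\<lambda>c. \<bar>\<psi> c\<bar>"] abs_int that
      by (simp add: integrable_continuous_real \<psi>')
    finally have le: "\<bar>f t - f s\<bar> \<le> integral {s..t} (\<lambda>c. \<bar>\<psi> c\<bar>)" .
    have "((\<lambda>c. \<bar>\<psi> c\<bar>) has_integral integral {s..t} (\<lambda>c. \<bar>\<psi> c\<bar>)) {s..t}"
      using abs_int that by (simp add: integrable_integral)
    then have "((\<lambda>c. \<bar>\<psi> c\<bar>) has_integral integral {s..t} (\<lambda>c. \<bar>\<psi> c\<bar>)) (box s t)"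
      using has_integral_open_interval[of "\<lambda>c. \<bar>\<psi> c\<bar>" _ s t] by (simp add: cbox_interval)
    then have "((\<lambda>c. if c \<in> box s t then \<bar>\<psi> c\<bar> else 0) has_integral integral {s..t} (\<lambda>c. \<bar>\<psi> c\<bar>)) {A..B}"
      using that by (subst has_integral_restrict) (auto simp: box_real)
    then show ?thesis using le by (auto simp: box_real)
  qed
  have mem: "A \<le> a \<bullet> (S ! i)" "a \<bullet> (S ! i) \<le> B" if "i \<le> n" "S \<noteq> []" for i
  proof -
    have "i < length S" using that unfolding n_def by (cases S) auto
    then show "A \<le> a \<bullet> (S ! i)" "a \<bullet> (S ! i) \<le> B" using S[of "S ! i"] by auto
  qed
  have step: "h i integrable_on {A..B} \<and> \<bar>f (a \<bullet> (S ! Suc i)) - f (a \<bullet> (S ! i))\<bar> \<le> integral {A..B} (h i)"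
    if "i < n" for i
  proof -
    let ?s = "a \<bullet> (S ! i)" and ?t = "a \<bullet> (S ! Suc i)"
    have ne: "S \<noteq> []" using that unfolding n_def by auto
    have s: "A \<le> ?s" "?s \<le> B" and t: "A \<le> ?t" "?t \<le> B" using mem[OF _ ne] that by auto
    have "\<exists>J. (h i has_integral J) {A..B} \<and> \<bar>f ?t - f ?s\<bar> \<le> J"
    proof (cases "?s \<le> ?t")
      case True
      then have "h i = (\<lambda>c. if ?s < c \<and> c < ?t then \<bar>\<psi> c\<bar> else 0)"
        by (auto simp: h_def opposite_sides_def fun_eq_iff)
      with incr[OF s(1) True t(2)] show ?thesis by simp
    next
      case False
      then have "h i = (\<lambda>c. if ?t < c \<and> c < ?s then \<bar>\<psi> c\<bar> else 0)"
        by (auto simp: h_def opposite_sides_def fun_eq_iff)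
      with incr[OF t(1) _ s(2)] False show ?thesis by (simp add: abs_minus_commute)
    qed
    then show ?thesis by (auto simp: integral_unique)
  qed
  have count: "(\<Sum>i<n. h i c) \<le> \<bar>\<psi> c\<bar> * real (vf S)" for c
  proof -
    let ?I = "{i. i < n \<and> opposite_sides a c (S ! i) (S ! Suc i)}"
    have "(\<Sum>i<n. h i c) = (\<Sum>i\<in>?I. \<bar>\<psi> c\<bar>)"
      unfolding h_def by (simp add: sum.If_cases Int_def)
    also have "\<dots> = \<bar>\<psi> c\<bar> * real (card ?I)" by simp
    also have "card ?I \<le> vf_line S a c"
      unfolding vf_line_def n_def
      by (rule card_mono[OF finite_crossings]) (auto simp: crossing_segment_def)
    also have "vf_line S a c \<le> vf S" by (rule vf_line_le_vf[OF a False])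
    finally show ?thesis by (simp add: mult_left_mono)
  qed
  have "cvar (\<lambda>z. complex_of_real (f (a \<bullet> z))) S = (\<Sum>i<n. \<bar>f (a \<bullet> (S ! Suc i)) - f (a \<bullet> (S ! i))\<bar>)"
    unfolding cvar_def n_def of_real_diff[symmetric] norm_of_real ..
  also have "\<dots> \<le> (\<Sum>i<n. integral {A..B} (h i))"
    using step by (intro sum_mono) auto
  also have "\<dots> = integral {A..B} (\<lambda>c. \<Sum>i<n. h i c)"
    using step by (subst integral_sum) auto
  also have "\<dots> \<le> integral {A..B} (\<lambda>c. \<bar>\<psi> c\<bar> * real (vf S))"
    using step count abs_int[of A B]
    by (intro integral_le integrable_sum) (auto intro: integrable_on_mult_left)
  also have "\<dots> = integral {A..B} (\<lambda>c. \<bar>\<psi> c\<bar>) * real (vf S)" by simp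
  finally show ?thesis .
qed

lemma BV_ridge:
  fixes f \<psi> :: "real \<Rightarrow> real"
  assumes a: "a \<noteq> 0" and S: "\<And>z. z \<in> \<sigma> \<Longrightarrow> A \<le> a \<bullet> z \<and> a \<bullet> z \<le> B"
    and d: "\<And>t. A \<le> t \<Longrightarrow> t \<le> B \<Longrightarrow> (f has_real_derivative \<psi> t) (at t within {A..B})"
    and \<psi>: "continuous_on {A..B} \<psi>"
    and M: "\<And>t. A \<le> t \<Longrightarrow> t \<le> B \<Longrightarrow> \<bar>f t\<bar> \<le> M" "0 \<le> M"
  shows "restr \<sigma> (\<lambda>z. of_real (f (a \<bullet> z))) \<in> BV \<sigma>"
    and "bv_norm \<sigma> (restr \<sigma> (\<lambda>z. of_real (f (a \<bullet> z)))) \<le> M + integral {A..B} (\<lambda>c. \<bar>\<psi> c\<bar>)"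
proof -
  have nn: "0 \<le> integral {A..B} (\<lambda>c. \<bar>\<psi> c\<bar>)"
    by (intro integral_nonneg integrable_continuous_real continuous_intros \<psi>) auto
  have v: "cvar (restr \<sigma> (\<lambda>z. of_real (f (a \<bullet> z)))) T \<le> integral {A..B} (\<lambda>c. \<bar>\<psi> c\<bar>) * real (vf T)"
    if "T \<noteq> []" "set T \<subseteq> \<sigma>" for T
  proof -
    have "T ! i \<in> \<sigma>" if "i < length T" for i using that \<open>set T \<subseteq> \<sigma>\<close> by auto
    then have "cvar (restr \<sigma> (\<lambda>z. of_real (f (a \<bullet> z)))) T = cvar (\<lambda>z. of_real (f (a \<bullet> z))) T"
      unfolding cvar_def by (intro sum.cong) (auto simp: restr_def)
    also have "\<dots> \<le> integral {A..B} (\<lambda>c. \<bar>\<psi> c\<bar>) * real (vf T)"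
      using that S by (intro cvar_ridge_le[OF a _ d \<psi>]) auto
    finally show ?thesis .
  qed
  have m: "norm (restr \<sigma> (\<lambda>z. of_real (f (a \<bullet> z))) z) \<le> M" if "z \<in> \<sigma>" for z
    using M(1) S[OF that] that by (simp add: restr_def)
  show "restr \<sigma> (\<lambda>z. of_real (f (a \<bullet> z))) \<in> BV \<sigma>"
    and "bv_norm \<sigma> (restr \<sigma> (\<lambda>z. of_real (f (a \<bullet> z)))) \<le> M + integral {A..B} (\<lambda>c. \<bar>\<psi> c\<bar>)"
    by (rule BV_I[OF m v M(2) nn]; simp add: restr_def)+
qed

text \<open>The norm of \<open>f (a \<bullet> z)\<close> is controlled by the derivative of \<open>f\<close>, so it suffices to approximate
the derivative uniformly by a polynomial (Weierstrass) and to integrate that polynomial.\<close>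
lemma AC_ridge:
  fixes f \<psi> :: "real \<Rightarrow> real"
  assumes a: "a \<noteq> 0" and S: "\<And>z. z \<in> \<sigma> \<Longrightarrow> A \<le> a \<bullet> z \<and> a \<bullet> z \<le> B"
    and d: "\<And>t. A \<le> t \<Longrightarrow> t \<le> B \<Longrightarrow> (f has_real_derivative \<psi> t) (at t within {A..B})"
    and \<psi>: "continuous_on {A..B} \<psi>" and AB: "A \<le> B"
  shows "restr \<sigma> (\<lambda>z. of_real (f (a \<bullet> z))) \<in> AC \<sigma>"
proof -
  let ?F = "\<lambda>f. restr \<sigma> (\<lambda>z. complex_of_real (f (a \<bullet> z)))"
  have bdd: "\<exists>M\<ge>0. \<forall>t. A \<le> t \<longrightarrow> t \<le> B \<longrightarrow> \<bar>h t\<bar> \<le> M" if "continuous_on {A..B} h" for h :: "real \<Rightarrow> real"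
  proof -
    have "bounded (h ` {A..B})"
      by (intro compact_imp_bounded compact_continuous_image that) simp
    then obtain M where "0 < M" "\<forall>x\<in>h ` {A..B}. norm x \<le> M" by (auto simp: bounded_pos)
    then show ?thesis by (intro exI[of _ M]) auto
  qed
  have C1_BV: "?F h \<in> BV \<sigma>"
    if "\<And>t. A \<le> t \<Longrightarrow> t \<le> B \<Longrightarrow> (h has_real_derivative k t) (at t within {A..B})" "continuous_on {A..B} k" for h k
  proof -
    have "continuous_on {A..B} h"
      using that(1) by (intro DERIV_continuous_on[of _ _ k]) auto
    from bdd[OF this] show ?thesis using BV_ridge(1)[OF a S that] by blast
  qed
  show ?thesis unfolding AC_iff
  proof (intro conjI allI impI)
    show "?F f \<in> BV \<sigma>" by (rule C1_BV[OF d \<psi>])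
    fix e :: real assume e: "0 < e"
    define \<epsilon> where "\<epsilon> = e / (2 * (B - A) + 1)"
    have \<epsilon>: "0 < \<epsilon>" using e AB by (auto simp: \<epsilon>_def)
    have "\<epsilon> * (2 * (B - A) + 1) = e" using AB by (simp add: \<epsilon>_def)
    with \<epsilon> have \<epsilon>': "\<epsilon> * (B - A) + \<epsilon> * (B - A) < e" by (simp add: algebra_simps)
    obtain q where q: "real_polynomial_function q" "\<And>t. t \<in> {A..B} \<Longrightarrow> \<bar>\<psi> t - q t\<bar> < \<epsilon>"
      by (rule Stone_Weierstrass_real_polynomial_function[OF compact_Icc \<psi> \<epsilon>]) (rule that)
    then obtain c n where qc: "q = (\<lambda>t. \<Sum>i\<le>n. c i * t ^ i)"
      by (auto simp: real_polynomial_function_iff_sum)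
    \<comment> \<open>The antiderivative of \<open>q\<close> that agrees with \<open>f\<close> at \<open>A\<close>.\<close>
    define P where "P t = f A + (\<Sum>i\<le>n. (c i / real (Suc i)) * (t ^ Suc i - A ^ Suc i))" for t
    have dP: "(P has_real_derivative q t) (at t within X)" for t X
    proof -
      have "((\<lambda>t. (c i / real (Suc i)) * (t ^ Suc i - A ^ Suc i)) has_real_derivative c i * t ^ i) (at t within X)" for i
        by (rule derivative_eq_intros refl)+ (simp del: of_nat_Suc)
      then have "(P has_real_derivative 0 + (\<Sum>i\<le>n. c i * t ^ i)) (at t within X)"
        unfolding P_def by (intro DERIV_add DERIV_const DERIV_sum)
      then show ?thesis by (simp add: qc)
    qed
    have cq: "continuous_on {A..B} q" unfolding qc by (intro continuous_intros)
    have dD: "((\<lambda>t. f t - P t) has_real_derivative \<psi> t - q t) (at t within {A..B})" if "A \<le> t" "t \<le> B" for t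
      by (intro DERIV_diff d dP that)
    have cD: "continuous_on {A..B} (\<lambda>t. \<psi> t - q t)" by (intro continuous_intros \<psi> cq)
    have small: "\<bar>f t - P t\<bar> \<le> \<epsilon> * (B - A)" if "A \<le> t" "t \<le> B" for t
    proof -
      have "norm ((f t - P t) - (f A - P A)) \<le> \<epsilon> * norm (t - A)"
        using that q(2) by (intro field_differentiable_bound[of "{A..B}", OF _ dD]) (auto intro: less_imp_le)
      also have "\<dots> \<le> \<epsilon> * (B - A)" using that \<epsilon> by (intro mult_left_mono) auto
      finally show ?thesis by (simp add: P_def)
    qed
    have "integral {A..B} (\<lambda>t. \<bar>\<psi> t - q t\<bar>) \<le> integral {A..B} (\<lambda>t. \<epsilon>)"
      using q(2) by (intro integral_le integrable_continuous_real continuous_intros \<psi> cq) (auto intro: less_imp_le)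
    then have int: "integral {A..B} (\<lambda>t. \<bar>\<psi> t - q t\<bar>) \<le> \<epsilon> * (B - A)"
      using AB by (simp add: mult.commute)
    have "bv_norm \<sigma> (?F (\<lambda>t. f t - P t)) \<le> \<epsilon> * (B - A) + integral {A..B} (\<lambda>t. \<bar>\<psi> t - q t\<bar>)"
      using \<epsilon> AB by (intro BV_ridge(2)[OF a S dD cD small]) auto
    also have "\<dots> < e" using int \<epsilon>' by simp
    also have "?F (\<lambda>t. f t - P t) = (\<lambda>z. ?F f z - ?F P z)"
      by (auto simp: restr_def fun_eq_iff)
    finally have lt: "bv_norm \<sigma> (\<lambda>z. ?F f z - ?F P z) < e" .
    have "?F P = restr \<sigma> (\<lambda>z. of_real (f A - (\<Sum>i\<le>n. (c i / real (Suc i)) * A ^ Suc i)) +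
        (\<Sum>i\<le>n. of_real (c i / real (Suc i)) * of_real (a \<bullet> z) ^ Suc i))"
      by (simp add: P_def restr_def fun_eq_iff sum_subtractf algebra_simps del: of_nat_Suc power_Suc)
    also have "\<dots> \<in> polynomials_on \<sigma>"
      by (intro polynomials_on_add polynomials_on_sum polynomials_on_mult polynomials_on_power
          polynomials_on_const polynomials_on_inner)
    finally show "\<exists>p\<in>polynomials_on \<sigma>. p \<in> BV \<sigma> \<and> bv_norm \<sigma> (\<lambda>z. ?F f z - p z) < e"
      using lt C1_BV[OF dP cq] by blast
  qed
qed

text \<open>The function \<open>u t = (max 0 t)\<^sup>2\<close> is continuously differentiable, vanishes for \<open>t \<le> 0\<close> and is at
least 1 for \<open>t \<ge> 1\<close>.  Then \<open>1 - u (1 - u t)\<close> is still continuously differentiable, and the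
second application of \<open>u\<close> makes it constant for \<open>t \<ge> 1\<close> as well.\<close>
lemma smooth_step:
  fixes c d :: real
  assumes "c < d"
  obtains g \<psi> :: "real \<Rightarrow> real" where
    "\<And>t X. (g has_real_derivative \<psi> t) (at t within X)" "continuous_on UNIV \<psi>"
    "\<And>t. 0 \<le> \<psi> t" "\<And>t. 0 \<le> g t" "\<And>t. g t \<le> 1" "\<And>t. t \<le> c \<Longrightarrow> g t = 0" "\<And>t. d \<le> t \<Longrightarrow> g t = 1"
proof -
  define u where "u t = (max 0 t)\<^sup>2" for t :: real
  have du: "(u has_real_derivative 2 * max 0 t) (at t)" for t
  proof -
    consider "t < 0" | "t = 0" | "0 < t" by linarith
    then show ?thesis
    proof cases
      case 1
      have "((\<lambda>t. 0) has_real_derivative 0) (at t)" by simp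
      then have "(u has_real_derivative 0) (at t)"
        by (rule has_field_derivative_transform_within_open[of _ _ _ "{..<0}"]) (use 1 in \<open>auto simp: u_def\<close>)
      with 1 show ?thesis by simp
    next
      case 2
      have "((\<lambda>h. max 0 h) \<longlongrightarrow> max 0 0) (at (0::real))" by (intro tendsto_intros)
      moreover have "(u h - u 0) / (h - 0) = max 0 h" if "h \<noteq> 0" for h
        using that by (auto simp: u_def power2_eq_square max_def)
      ultimately have "((\<lambda>h. (u h - u 0) / (h - 0)) \<longlongrightarrow> 0) (at 0)"
        by (subst tendsto_cong[of _ "\<lambda>h. max 0 h"]) (auto simp: eventually_at_filter)
      with 2 show ?thesis by (simp add: has_field_derivative_iff)
    next
      case 3
      have "((\<lambda>t. t\<^sup>2) has_real_derivative 2 * t) (at t)" by (auto intro!: derivative_eq_intros)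
      then have "(u has_real_derivative 2 * t) (at t)"
        by (rule has_field_derivative_transform_within_open[of _ _ _ "{0<..}"]) (use 3 in \<open>auto simp: u_def\<close>)
      with 3 show ?thesis by simp
    qed
  qed
  define s where "s t = (t - c) / (d - c)" for t
  define g where "g t = 1 - u (1 - u (s t))" for t
  define \<psi> where "\<psi> t = 2 * max 0 (1 - u (s t)) * (2 * max 0 (s t) * (1 / (d - c)))" for t
  have ds: "(s has_real_derivative 1 / (d - c)) (at t)" for t
    unfolding s_def using assms by (auto intro!: derivative_eq_intros)
  have "(g has_real_derivative \<psi> t) (at t)" for t
  proof -
    have "((\<lambda>t. u (s t)) has_real_derivative 2 * max 0 (s t) * (1 / (d - c))) (at t)"
      by (rule DERIV_chain2[OF du ds])
    then have "((\<lambda>t. 1 - u (s t)) has_real_derivative - (2 * max 0 (s t) * (1 / (d - c)))) (at t)"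
      by (auto intro!: derivative_eq_intros)
    from DERIV_chain2[OF du this] show ?thesis
      unfolding g_def \<psi>_def by (auto intro!: derivative_eq_intros)
  qed
  then have 1: "(g has_real_derivative \<psi> t) (at t within X)" for t X
    by (rule DERIV_subset) simp
  have 2: "continuous_on UNIV \<psi>"
    unfolding \<psi>_def u_def s_def by (intro continuous_intros) (use assms in auto)
  have u01: "0 \<le> u t" "t \<le> 1 \<Longrightarrow> u t \<le> 1" for t
    by (auto simp: u_def max_def power_le_one)
  have 3: "0 \<le> \<psi> t" "0 \<le> g t" "g t \<le> 1" for t
    using assms u01 by (auto simp: \<psi>_def g_def)
  have 4: "g t = 0" if "t \<le> c" for t
  proof -
    have "s t \<le> 0" using that assms by (simp add: s_def divide_nonpos_pos)
    then show ?thesis by (simp add: g_def u_def)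
  qed
  have 5: "g t = 1" if "d \<le> t" for t
  proof -
    have "1 \<le> s t" using that assms by (simp add: s_def)
    then have "1 \<le> u (s t)" by (simp add: u_def)
    then show ?thesis by (simp add: g_def u_def[of "1 - u (s t)"])
  qed
  show ?thesis using that[OF 1 2 3(1,2,3) 4 5] .
qed

text \<open>A monotone step has variation 1 no matter how steep it is.  The norm of \<open>G\<close> is therefore
bounded independently of the width \<open>d - c\<close> of the strip in which \<open>G\<close> changes.\<close>
lemma AC_step:
  fixes c d :: real
  assumes "bounded \<sigma>" "a \<noteq> 0" "c < d"
  obtains G where "G \<in> AC \<sigma>" "bv_norm \<sigma> G \<le> 2"
    "\<And>z. z \<in> \<sigma> \<Longrightarrow> a \<bullet> z \<le> c \<Longrightarrow> G z = 0" "\<And>z. z \<in> \<sigma> \<Longrightarrow> d \<le> a \<bullet> z \<Longrightarrow> G z = 1"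
proof -
  obtain R where R: "0 < R" "\<And>z. z \<in> \<sigma> \<Longrightarrow> norm z \<le> R"
    using assms(1) by (auto simp: bounded_pos)
  define B where "B = norm a * R"
  have B: "0 \<le> B" using R by (simp add: B_def)
  have AB: "- B \<le> a \<bullet> z \<and> a \<bullet> z \<le> B" if "z \<in> \<sigma>" for z
  proof -
    have "\<bar>a \<bullet> z\<bar> \<le> norm a * norm z" by (rule Cauchy_Schwarz_ineq2)
    also have "\<dots> \<le> B" unfolding B_def using R(2)[OF that] by (intro mult_left_mono) auto
    finally show ?thesis by auto
  qed
  from smooth_step[OF assms(3)] obtain g \<psi> :: "real \<Rightarrow> real" where g:
    "\<And>t X. (g has_real_derivative \<psi> t) (at t within X)" "continuous_on UNIV \<psi>"
    "\<And>t. 0 \<le> \<psi> t" "\<And>t. 0 \<le> g t" "\<And>t. g t \<le> 1" "\<And>t. t \<le> c \<Longrightarrow> g t = 0" "\<And>t. d \<le> t \<Longrightarrow> g t = 1"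
    by blast
  have c\<psi>: "continuous_on {- B..B} \<psi>" using g(2) by (rule continuous_on_subset) simp
  have "(\<psi> has_integral g B - g (- B)) {- B..B}"
    using B g(1) by (intro fundamental_theorem_of_calculus)
      (auto simp: has_real_derivative_iff_has_vector_derivative[symmetric])
  then have int: "integral {- B..B} (\<lambda>t. \<bar>\<psi> t\<bar>) \<le> 1"
    using g(3) g(5)[of B] g(4)[of "- B"] by (simp add: integral_unique)
  let ?G = "restr \<sigma> (\<lambda>z. of_real (g (a \<bullet> z)))"
  have "bv_norm \<sigma> ?G \<le> 1 + integral {- B..B} (\<lambda>t. \<bar>\<psi> t\<bar>)"
    using g(4,5) by (intro BV_ridge(2)[OF assms(2) AB g(1) c\<psi>]) (auto simp: abs_le_iff intro: order_trans[of _ 0])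
  with int have "bv_norm \<sigma> ?G \<le> 2" by simp
  moreover have "?G \<in> AC \<sigma>" using B by (intro AC_ridge[OF assms(2) AB g(1) c\<psi>]) auto
  ultimately show ?thesis using that[of ?G] g(6,7) by (auto simp: restr_def)
qed

section \<open>Monotone lists on a line\<close>

text \<open>The pairs \<open>(a, c)\<close> and \<open>(- a, - c)\<close> describe the same line; reversing the sign turns decreasing
coordinates into increasing ones.\<close>
lemma crossing_segment_minus: "crossing_segment S (- a) (- c) i = crossing_segment S a c i"
  by (auto simp: crossing_segment_def opposite_sides_def line_def)

lemma vf_line_minus: "vf_line S (- a) (- c) = vf_line S a c"
  by (simp add: vf_line_def crossing_segment_minus)

lemma card_le_1I: "(\<And>i j. i \<in> I \<Longrightarrow> j \<in> I \<Longrightarrow> i < j \<Longrightarrow> False) \<Longrightarrow> card (I::nat set) \<le> 1"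
proof (cases "finite I")
  case True
  assume *: "\<And>i j. i \<in> I \<Longrightarrow> j \<in> I \<Longrightarrow> i < j \<Longrightarrow> False"
  have "i = j" if "i \<in> I" "j \<in> I" for i j
    using *[of i j] *[of j i] that by (cases i j rule: linorder_cases) auto
  then show ?thesis using card_le_Suc0_iff_eq[OF True] by auto
qed simp

text \<open>When the coordinate \<open>a \<bullet> z\<close> increases along the list, a crossing segment with index \<open>i\<close> starts at
a value at most \<open>c\<close>, and all segments after it start beyond \<open>c\<close>.  A segment that only reaches the
line at its end point is counted only if it is the last one.\<close>
lemma vf_line_increasing:
  assumes "\<And>i. Suc i < length S \<Longrightarrow> a \<bullet> (S ! i) < a \<bullet> (S ! Suc i)"
  shows "vf_line S a c \<le> 1"
  unfolding vf_line_def
proof (rule card_le_1I)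
  fix i j
  assume i: "i \<in> {i. Suc i < length S \<and> crossing_segment S a c i}"
    and j: "j \<in> {i. Suc i < length S \<and> crossing_segment S a c i}" and "i < j"
  have "Suc j < length S" using j by simp
  have mono: "a \<bullet> (S ! Suc i) \<le> a \<bullet> (S ! j)"
  proof -
    have "Suc i \<le> j" using \<open>i < j\<close> by simp
    then show ?thesis
      using \<open>Suc j < length S\<close>
    proof (induction j rule: dec_induct)
      case base
      then show ?case by simp
    next
      case (step m)
      then show ?case using assms[of m] by auto
    qed
  qed
  have "c < a \<bullet> (S ! Suc i)"
    using i assms[of i] \<open>i < j\<close> \<open>Suc j < length S\<close>
    by (auto simp: crossing_segment_def opposite_sides_def line_def)
  moreover have "a \<bullet> (S ! j) \<le> c"
    using j assms[of j] \<open>i < j\<close> \<open>Suc j < length S\<close> mono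
    by (auto simp: crossing_segment_def opposite_sides_def line_def)
  ultimately show False using mono by simp
qed

lemma vf_line_constant:
  assumes "\<And>i. i < length S \<Longrightarrow> a \<bullet> (S ! i) = b"
  shows "vf_line S a c \<le> 1"
  unfolding vf_line_def
  by (rule card_le_1I) (auto simp: crossing_segment_def opposite_sides_def line_def assms)

text \<open>Along the list every coordinate \<open>a \<bullet> z\<close> is constant or strictly monotone, so no line has more
than one crossing segment.  On such a list the variation factor drops out, and the variation is
the usual one-dimensional one.\<close>
lemma vf_ray_le_1:
  fixes w :: complex and t :: "nat \<Rightarrow> real"
  assumes t: "\<And>i. t (Suc i) < t i"
  shows "vf (map (\<lambda>i. t i *\<^sub>R w) [0..<n]) \<le> 1"
proof -
  let ?S = "map (\<lambda>i. t i *\<^sub>R w) [0..<n]"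
  have "vf_line ?S a c \<le> 1" for a c
  proof -
    consider "a \<bullet> w < 0" | "a \<bullet> w = 0" | "0 < a \<bullet> w" by linarith
    then show ?thesis
    proof cases
      case 1
      then show ?thesis using t by (intro vf_line_increasing) (simp add: mult_strict_right_mono_neg)
    next
      case 2
      then show ?thesis by (intro vf_line_constant[where b = 0]) simp
    next
      case 3
      then have "vf_line ?S (- a) (- c) \<le> 1" using t by (intro vf_line_increasing) simp
      then show ?thesis by (simp only: vf_line_minus)
    qed
  qed
  then show ?thesis
    unfolding vf_def using finite_vf_line[of ?S] nonempty_vf_line[of ?S] by auto
qed

section \<open>Sets on finitely many rays\<close>

text \<open>All rays lie in one open half plane and consecutive slopes differ by 1, which leaves room for the
separating lines of slopes \<open>i - 1/2\<close> and \<open>i + 1/2\<close>.\<close>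
definition ray_point :: "nat \<Rightarrow> nat \<Rightarrow> complex" where
  "ray_point j m = (1 / real (Suc m)) *\<^sub>R Complex 1 (real j)"

definition ray_set :: "nat \<Rightarrow> complex set" where
  "ray_set k = insert 0 {ray_point j m |j m. j < k}"

lemma inner_ray_point: "Complex p q \<bullet> ray_point j m = (p + q * real j) / real (Suc m)"
  by (simp add: ray_point_def inner_complex_def add_divide_distrib del: of_nat_Suc)

lemma ray_point_nonzero: "ray_point j m \<noteq> 0"
  by (simp add: ray_point_def complex_eq_iff)

lemma ray_point_eq_iff: "ray_point i m = ray_point j n \<longleftrightarrow> i = j \<and> m = n"
  by (auto simp: ray_point_def complex_eq_iff)

lemma inj_ray_point: "inj (ray_point j)"
  by (auto simp: inj_def ray_point_eq_iff)

lemma norm_ray_point: "norm (ray_point j m) \<le> (1 + real j) / real (Suc m)"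
proof -
  have "norm (Complex 1 (real j)) \<le> 1 + real j"
    using cmod_le[of "Complex 1 (real j)"] by simp
  then show ?thesis by (simp add: ray_point_def divide_right_mono)
qed

text \<open>This makes 0 the only possible limit point, and hence the set closed.\<close>
lemma finite_ray_set_outside:
  assumes "0 < e"
  shows "finite {z \<in> ray_set k. e \<le> norm z}"
proof -
  define N where "N = nat \<lceil>(1 + real k) / e\<rceil>"
  have "{z \<in> ray_set k. e \<le> norm z} \<subseteq> (\<lambda>(j, m). ray_point j m) ` ({..<k} \<times> {..<N})"
  proof
    fix z assume "z \<in> {z \<in> ray_set k. e \<le> norm z}"
    with assms obtain j m where z: "z = ray_point j m" "j < k" "e \<le> norm z"
      by (auto simp: ray_set_def)
    have "e \<le> (1 + real j) / real (Suc m)" using z norm_ray_point[of j m] by simp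
    also have "\<dots> < (1 + real k) / real (Suc m)" using z by (simp add: divide_strict_right_mono)
    finally have "real (Suc m) < (1 + real k) / e" using assms by (simp add: field_simps)
    then have "m < N" unfolding N_def by linarith
    with z show "z \<in> (\<lambda>(j, m). ray_point j m) ` ({..<k} \<times> {..<N})" by auto
  qed
  then show ?thesis by (rule finite_subset) auto
qed

lemma bounded_ray_set: "bounded (ray_set k)"
proof -
  have "ray_set k \<subseteq> ball 0 1 \<union> {z \<in> ray_set k. 1 \<le> norm z}" by auto
  then show ?thesis
    using finite_ray_set_outside[of 1 k]
    by (meson bounded_Un bounded_ball bounded_subset finite_imp_bounded zero_less_one)
qed

lemma C_set_ray_set:
  assumes "0 < k"
  shows "C_set (ray_set k)"
proof -
  have "ray_set k = insert 0 ((\<lambda>(j, m). ray_point j m) ` ({..<k} \<times> UNIV))"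
    by (auto simp: ray_set_def)
  then have count: "countable (ray_set k)" by auto
  have sub: "range (ray_point 0) \<subseteq> ray_set k" using assms by (auto simp: ray_set_def)
  then have inf: "infinite (ray_set k)"
    using finite_subset range_inj_infinite[OF inj_ray_point] by blast
  have away: "\<not> z islimpt ray_set k" if "z \<noteq> 0" for z
  proof
    assume "z islimpt ray_set k"
    then have "infinite (ray_set k \<inter> ball z (norm z / 2))"
      using that by (auto simp: islimpt_eq_infinite_ball)
    moreover have "ray_set k \<inter> ball z (norm z / 2) \<subseteq> {x \<in> ray_set k. norm z / 2 \<le> norm x}"
    proof
      fix x assume x: "x \<in> ray_set k \<inter> ball z (norm z / 2)"
      have "norm z \<le> norm x + norm (z - x)" by (rule norm_triangle_sub)
      with x show "x \<in> {x \<in> ray_set k. norm z / 2 \<le> norm x}" by (auto simp: dist_norm)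
    qed
    moreover have "finite {x \<in> ray_set k. norm z / 2 \<le> norm x}"
      using that by (intro finite_ray_set_outside) simp
    ultimately show False using finite_subset by blast
  qed
  have zero: "0 islimpt ray_set k"
    unfolding islimpt_eq_infinite_ball
  proof (intro allI impI notI)
    fix e :: real assume "0 < e" "finite (ray_set k \<inter> ball 0 e)"
    then have "finite ((ray_set k \<inter> ball 0 e) \<union> {z \<in> ray_set k. e \<le> norm z})"
      using finite_ray_set_outside by auto
    moreover have "ray_set k \<subseteq> (ray_set k \<inter> ball 0 e) \<union> {z \<in> ray_set k. e \<le> norm z}" by auto
    ultimately show False using inf finite_subset by blast
  qed
  have "closed (ray_set k)"
    unfolding closed_limpt using away by (auto simp: ray_set_def)
  then have "compact (ray_set k)" using bounded_ray_set by (simp add: compact_eq_bounded_closed)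
  then show ?thesis unfolding C_set_def using count inf away zero by auto
qed

lemma inj_ray_set: "inj ray_set"
proof (rule injI)
  have *: "ray_point j 0 \<in> ray_set k \<longleftrightarrow> j < k" for j k
    using ray_point_nonzero by (auto simp: ray_set_def ray_point_eq_iff)
  fix k l assume "ray_set k = ray_set l"
  then have "j < k \<longleftrightarrow> j < l" for j using * by metis
  then show "k = l" by (metis linorder_neqE_nat less_irrefl)
qed

section \<open>Idempotents carried by one ray\<close>

definition ray_head :: "nat \<Rightarrow> nat \<Rightarrow> complex \<Rightarrow> complex" where
  "ray_head i n z = (if z \<in> ray_point i ` {..n} then 1 else 0)"

lemma ray_head_0: "ray_head i n 0 = 0"
  using ray_point_nonzero by (auto simp: ray_head_def)

lemma ray_head_ray_point: "ray_head i n (ray_point j m) = (if j = i \<and> m \<le> n then 1 else 0)"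
  by (auto simp: ray_head_def ray_point_eq_iff)

lemma ray_head_mult: "ray_head i n z * ray_head j m z = (if i = j then ray_head i (min n m) z else 0)"
  by (auto simp: ray_head_def ray_point_eq_iff)

text \<open>The first points of the ray with slope \<open>i\<close> are cut out by two half planes.  One boundary line has
a slope just below \<open>i\<close> and separates them from the rays below and from the tail of their own ray,
the other one has a slope just above \<open>i\<close> and separates them from the rays above.  The product
of the two corresponding steps is the indicator function: where one of the factors has an
intermediate value, the other one vanishes.  What matters is that the bound 4 does not depend
on \<open>n\<close>.\<close>
lemma AC_ray_head:
  assumes "i < k"
  shows "ray_head i n \<in> AC (ray_set k)" and "bv_norm (ray_set k) (ray_head i n) \<le> 4"
proof -
  \<comment> \<open>On the ray with slope \<open>i\<close> both \<open>a \<bullet> z\<close> and \<open>b \<bullet> z\<close> are half the real part of \<open>z\<close>; the values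
    of the last point of the head and of the next point are \<open>d\<close> and \<open>c\<close>.\<close>
  define c d where "c = 1 / (2 * real (n + 2))" and "d = 1 / (2 * real (n + 1))"
  have cd: "c < d" "0 < c" by (auto simp: c_def d_def field_simps)
  define a b where "a = Complex (1 / 2 - real i) 1" and "b = Complex (1 / 2 + real i) (- 1)"
  have ab: "a \<noteq> 0" "b \<noteq> 0" by (auto simp: a_def b_def complex_eq_iff)
  have inner: "a \<bullet> ray_point j m = (1 / 2 - real i + real j) / real (Suc m)"
    "b \<bullet> ray_point j m = (1 / 2 + real i - real j) / real (Suc m)" for j m
    by (simp_all add: a_def b_def inner_ray_point del: of_nat_Suc)
  from AC_step[OF bounded_ray_set ab(1) cd(1)] obtain G where G:
    "G \<in> AC (ray_set k)" "bv_norm (ray_set k) G \<le> 2"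
    "\<And>z. z \<in> ray_set k \<Longrightarrow> a \<bullet> z \<le> c \<Longrightarrow> G z = 0"
    "\<And>z. z \<in> ray_set k \<Longrightarrow> d \<le> a \<bullet> z \<Longrightarrow> G z = 1" by blast
  from AC_step[OF bounded_ray_set ab(2) cd(1)] obtain H where H:
    "H \<in> AC (ray_set k)" "bv_norm (ray_set k) H \<le> 2"
    "\<And>z. z \<in> ray_set k \<Longrightarrow> b \<bullet> z \<le> c \<Longrightarrow> H z = 0"
    "\<And>z. z \<in> ray_set k \<Longrightarrow> d \<le> b \<bullet> z \<Longrightarrow> H z = 1" by blast
  have "G z * H z = ray_head i n z" for z
  proof (cases "z \<in> ray_set k")
    case False
    then have "ray_head i n z = 0" using assms by (auto simp: ray_head_def ray_set_def)
    then show ?thesis using BV_outside[OF AC_BV[OF G(1)] False] by simp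
  next
    case True
    show ?thesis
    proof (cases "z = 0")
      case z: True
      with G(3)[OF True] cd show ?thesis by (simp add: ray_head_0)
    next
      case False
      with True obtain j m where z: "z = ray_point j m" by (auto simp: ray_set_def)
      consider "j < i" | "i < j" | "j = i" "m \<le> n" | "j = i" "n < m" by linarith
      then show ?thesis
      proof cases
        case 1
        then have "a \<bullet> z \<le> 0" by (auto simp: z inner intro!: divide_nonpos_pos)
        with 1 z cd G(3)[OF True] show ?thesis by (simp add: ray_head_ray_point)
      next
        case 2
        then have "b \<bullet> z \<le> 0" by (auto simp: z inner intro!: divide_nonpos_pos)
        with 2 z cd H(3)[OF True] show ?thesis by (simp add: ray_head_ray_point)
      next
        case 3
        then have "d \<le> a \<bullet> z" "d \<le> b \<bullet> z" by (auto simp: z inner d_def field_simps)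
        with 3 z G(4)[OF True] H(4)[OF True] show ?thesis by (simp add: ray_head_ray_point)
      next
        case 4
        then have "a \<bullet> z \<le> c" by (auto simp: z inner c_def field_simps)
        with 4 z G(3)[OF True] show ?thesis by (simp add: ray_head_ray_point)
      qed
    qed
  qed
  then have eq: "ray_head i n = (\<lambda>z. G z * H z)" by (simp add: fun_eq_iff)
  show "ray_head i n \<in> AC (ray_set k)" unfolding eq using G(1) H(1) by (rule AC_mult)
  have "bv_norm (ray_set k) (ray_head i n) \<le> bv_norm (ray_set k) G * bv_norm (ray_set k) H"
    unfolding eq using G(1) H(1) by (intro BV_mult AC_BV)
  also have "\<dots> \<le> 2 * 2" using G(2) H(2) bv_norm_nonneg by (intro mult_mono) auto
  finally show "bv_norm (ray_set k) (ray_head i n) \<le> 4" by simp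
qed

section \<open>The number of rays is an invariant\<close>

lemma AC_zero: "(\<lambda>_. 0) \<in> AC \<sigma>"
  using AC_const(1)[of \<sigma> 0] by (simp add: restr_def[abs_def])

text \<open>As for linear operators, continuity at 0 gives a bound on a small ball, and homogeneity carries
it over to every ball.\<close>
lemma AC_homogeneous_bounded:
  assumes "continuous_map (AC_topology \<sigma>) (AC_topology \<tau>) \<Phi>"
    and "\<And>c f. f \<in> AC \<sigma> \<Longrightarrow> \<Phi> (\<lambda>z. c * f z) = (\<lambda>z. c * \<Phi> f z)"
  obtains C where "\<And>f. f \<in> AC \<sigma> \<Longrightarrow> bv_norm \<sigma> f \<le> R \<Longrightarrow> bv_norm \<tau> (\<Phi> f) \<le> C"
proof -
  have zero: "\<Phi> (\<lambda>_. 0) = (\<lambda>_. 0)"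
    using assms(2)[OF AC_zero, of 0] by simp
  have dist0: "BV_dist \<sigma> (\<lambda>_. 0) f = bv_norm \<sigma> f" for \<sigma> f
    unfolding BV_dist_eq bv_norm_def using BV_norm_minus_commute[of \<sigma> "\<lambda>_. 0" f] by simp
  have maps: "\<Phi> f \<in> AC \<tau>" if "f \<in> AC \<sigma>" for f
    using assms(1) that
    unfolding AC_topology_def Metric_space.metric_continuous_map[OF Metric_space_AC Metric_space_AC]
    by blast
  have "\<exists>d>0. \<forall>f. f \<in> AC \<sigma> \<and> BV_dist \<sigma> (\<lambda>_. 0) f < d \<longrightarrow> BV_dist \<tau> (\<Phi> (\<lambda>_. 0)) (\<Phi> f) < 1"
    using assms(1) AC_zero[of \<sigma>] zero_less_one[where 'a = real]
    unfolding AC_topology_def Metric_space.metric_continuous_map[OF Metric_space_AC Metric_space_AC]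
    by blast
  then obtain d where d: "0 < d" "\<And>f. f \<in> AC \<sigma> \<Longrightarrow> bv_norm \<sigma> f < d \<Longrightarrow> bv_norm \<tau> (\<Phi> f) < 1"
    by (auto simp: zero dist0)
  define r where "r = d / (1 + \<bar>R\<bar>)"
  have r: "0 < r" "r * \<bar>R\<bar> < d" using d(1) by (auto simp: r_def field_simps)
  have "bv_norm \<tau> (\<Phi> f) \<le> 1 / r" if f: "f \<in> AC \<sigma>" "bv_norm \<sigma> f \<le> R" for f
  proof -
    let ?f = "\<lambda>z. of_real r * f z"
    have "bv_norm \<sigma> ?f \<le> r * bv_norm \<sigma> f" using AC_scale(2)[OF f(1), of "of_real r"] r by simp
    also have "\<dots> \<le> r * \<bar>R\<bar>" using f(2) r by (intro mult_left_mono) auto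
    finally have "bv_norm \<tau> (\<Phi> ?f) < 1" using r d(2) AC_scale(1)[OF f(1)] by auto
    have "\<Phi> f = (\<lambda>z. of_real (1 / r) * \<Phi> ?f z)"
      using r unfolding assms(2)[OF f(1)] by (simp add: fun_eq_iff)
    moreover have "bv_norm \<tau> (\<lambda>z. of_real (1 / r) * \<Phi> ?f z)
        \<le> norm (complex_of_real (1 / r)) * bv_norm \<tau> (\<Phi> ?f)"
      by (intro AC_scale maps f(1))
    ultimately have "bv_norm \<tau> (\<Phi> f) \<le> (1 / r) * bv_norm \<tau> (\<Phi> ?f)"
      using r by (simp add: norm_divide)
    also have "\<dots> \<le> (1 / r) * 1"
      using r \<open>bv_norm \<tau> (\<Phi> ?f) < 1\<close> by (intro mult_left_mono) auto
    finally show ?thesis by simp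
  qed
  then show ?thesis by (rule that)
qed

lemma alternating_sequence:
  fixes N :: "bool \<Rightarrow> nat set"
  assumes "\<And>b. infinite (N b)"
  obtains s :: "nat \<Rightarrow> nat" where "\<And>r. s r \<in> N (even r)" "\<And>r. s r < s (Suc r)"
proof -
  have "\<exists>s. \<forall>r. s r \<in> N (even r) \<and> s r < s (Suc r)"
  proof (rule dependent_nat_choice)
    show "\<exists>x. x \<in> N (even 0)" using assms[of "even 0"] infinite_imp_nonempty by auto
    show "\<exists>y. y \<in> N (even (Suc r)) \<and> x < y" for x r
      using assms[of "even (Suc r)"] by (meson infinite_nat_iff_unbounded)
  qed
  then show ?thesis using that by blast
qed

text \<open>The points move along one ray towards the origin, so the variation factor of their list
is at most 1, while the values of \<open>f\<close> jump by 1 along each of its \<open>M\<close> segments.\<close>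
lemma ray_alternation_bounded:
  assumes f: "f \<in> BV (ray_set l)" and j: "j < l" and s: "\<And>r. s r < s (Suc r)"
    and alt: "\<And>r. r \<le> M \<Longrightarrow> f (ray_point j (s r)) = (if even r then 1 else 0)"
  shows "real M \<le> bv_norm (ray_set l) f"
proof -
  let ?S = "map (\<lambda>r. (1 / real (Suc (s r))) *\<^sub>R Complex 1 (real j)) [0..<Suc M]"
  have S: "?S ! r = ray_point j (s r)" if "r \<le> M" for r
    using that by (simp add: ray_point_def del: upt_Suc)
  have "vf ?S \<le> 1" using s by (intro vf_ray_le_1) (simp add: frac_less2)
  then have vf: "real (vf ?S) \<le> 1" by simp
  obtain K V where KV: "0 \<le> K" "0 \<le> V" "bv_norm (ray_set l) f = K + V"
    "\<And>S. S \<noteq> [] \<Longrightarrow> set S \<subseteq> ray_set l \<Longrightarrow> cvar f S \<le> V * real (vf S)"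
    using f by (rule BV_E) (rule that)
  have "cvar f ?S = (\<Sum>r<M. 1)"
    unfolding cvar_def
  proof (rule sum.cong)
    fix r assume "r \<in> {..<M}"
    then show "norm (f (?S ! Suc r) - f (?S ! r)) = 1"
      using S[of r] S[of "Suc r"] alt[of r] alt[of "Suc r"] by (simp del: upt_Suc)
  qed (simp del: upt_Suc)
  then have "real M = cvar f ?S" by simp
  also have "\<dots> \<le> V * real (vf ?S)"
    using j by (intro KV(4)) (auto simp: ray_set_def ray_point_def)
  also have "\<dots> \<le> V * 1" using vf KV(2) by (intro mult_left_mono) auto
  finally show ?thesis using KV by simp
qed

text \<open>The images of the heads of the \<open>k\<close> rays are idempotents on \<open>ray_set l\<close>, that is, indicator
functions of sets \<open>F i n\<close>.  For fixed \<open>i\<close> these sets grow strictly with \<open>n\<close>, so their union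
\<open>U i\<close> is infinite, and for different \<open>i\<close> they are disjoint.  If \<open>l < k\<close>, then two of the unions,
\<open>U i\<close> and \<open>U i'\<close>, have infinitely many points on the same ray.  A list that alternates between
them along that ray makes the variation of the indicator function of \<open>F i n\<close> as large as desired
when \<open>n\<close> is large, although \<open>\<Phi>\<close> is bounded and the heads have norm at most 4.\<close>
lemma AC_embedding_ray_count_le:
  assumes cont: "continuous_map (AC_topology (ray_set k)) (AC_topology (ray_set l)) \<Phi>"
    and inj: "inj_on \<Phi> (AC (ray_set k))"
    and scale: "\<And>c f. f \<in> AC (ray_set k) \<Longrightarrow> \<Phi> (\<lambda>z. c * f z) = (\<lambda>z. c * \<Phi> f z)"
    and mult: "\<And>f g. f \<in> AC (ray_set k) \<Longrightarrow> g \<in> AC (ray_set k) \<Longrightarrow>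
      \<Phi> (\<lambda>z. f z * g z) = (\<lambda>z. \<Phi> f z * \<Phi> g z)"
  shows "k \<le> l"
proof (rule ccontr)
  assume "\<not> k \<le> l"
  have maps: "\<Phi> f \<in> AC (ray_set l)" if "f \<in> AC (ray_set k)" for f
    using cont that
    unfolding AC_topology_def Metric_space.metric_continuous_map[OF Metric_space_AC Metric_space_AC]
    by blast
  have zero: "\<Phi> (\<lambda>_. 0) = (\<lambda>_. 0)"
    using scale[OF AC_zero, of 0] by simp
  define e where "e i n = \<Phi> (ray_head i n)" for i n
  have e_AC: "e i n \<in> AC (ray_set l)" if "i < k" for i n
    unfolding e_def by (intro maps AC_ray_head that)
  have e_mult: "e i n z * e j m z = (if i = j then e i (min n m) z else 0)" if "i < k" "j < k" for i j n m z
  proof -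
    have "(\<lambda>z. e i n z * e j m z) = \<Phi> (\<lambda>z. ray_head i n z * ray_head j m z)"
      unfolding e_def by (intro mult[symmetric] AC_ray_head that)
    also have "\<dots> = (if i = j then e i (min n m) else (\<lambda>_. 0))"
      by (simp add: ray_head_mult zero e_def)
    finally have "(\<lambda>z. e i n z * e j m z) = (if i = j then e i (min n m) else (\<lambda>_. 0))" .
    from fun_cong[OF this, of z] show ?thesis by (cases "i = j") simp_all
  qed
  have e_01: "e i n z = 0 \<or> e i n z = 1" if "i < k" for i n z
    using e_mult[OF that that, of n z n] by simp
  define F where "F i n = {z. e i n z = 1}" for i n
  define U where "U i = (\<Union>n. F i n)" for i
  have F_mono: "F i n \<subseteq> F i m" if "i < k" "n \<le> m" for i n m
  proof
    fix z assume "z \<in> F i n"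
    then show "z \<in> F i m"
      using e_mult[OF that(1) that(1), of n z m] that(2) by (simp add: F_def min_def)
  qed
  have F_sub: "F i n \<subseteq> ray_set l" if "i < k" for i n
    using BV_outside[OF AC_BV[OF e_AC[OF that]]] by (force simp: F_def)
  have inj_F: "inj (F i)" if "i < k" for i
  proof (rule injI)
    fix n m assume eq: "F i n = F i m"
    have "e i n z = e i m z" for z
    proof -
      have "e i n z = 1 \<longleftrightarrow> e i m z = 1" using eq by (auto simp: F_def)
      then show ?thesis using e_01[OF that, of n z] e_01[OF that, of m z] by auto
    qed
    then have "e i n = e i m" by (simp add: fun_eq_iff)
    then have "ray_head i n = ray_head i m"
      unfolding e_def by (rule inj_onD[OF inj _ AC_ray_head(1)[OF that] AC_ray_head(1)[OF that]])
    then have "ray_head i n (ray_point i r) = ray_head i m (ray_point i r)" for r by simp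
    from this[of n] this[of m] show "n = m" by (auto simp: ray_head_ray_point split: if_splits)
  qed
  have U_inf: "infinite (U i)" if "i < k" for i
  proof
    assume "finite (U i)"
    moreover have "range (F i) \<subseteq> Pow (U i)" by (auto simp: U_def)
    ultimately have "finite (range (F i))" by (simp add: finite_subset)
    with inj_F[OF that] show False using range_inj_infinite by blast
  qed
  have "\<exists>j<l. infinite {m. ray_point j m \<in> U i}" if "i < k" for i
  proof (rule ccontr)
    assume "\<not> ?thesis"
    then have "finite (insert 0 (\<Union>j<l. ray_point j ` {m. ray_point j m \<in> U i}))" by auto
    moreover have "U i \<subseteq> insert 0 (\<Union>j<l. ray_point j ` {m. ray_point j m \<in> U i})"
    proof
      fix z assume z: "z \<in> U i"
      then have "z \<in> ray_set l" using F_sub[OF that] by (auto simp: U_def)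
      with z show "z \<in> insert 0 (\<Union>j<l. ray_point j ` {m. ray_point j m \<in> U i})"
        by (auto simp: ray_set_def)
    qed
    ultimately show False using U_inf[OF that] finite_subset by blast
  qed
  then obtain J where J: "\<And>i. i < k \<Longrightarrow> J i < l \<and> infinite {m. ray_point (J i) m \<in> U i}" by metis
  have "card (J ` {..<k}) \<le> card {..<l}" using J by (intro card_mono) auto
  then have "\<not> inj_on J {..<k}" using \<open>\<not> k \<le> l\<close> by (intro pigeonhole) auto
  then obtain i i' where i: "i < k" "i' < k" "i \<noteq> i'" "J i = J i'" by (auto simp: inj_on_def)
  define j where "j = J i"
  have "infinite {m. ray_point j m \<in> U (if b then i else i')}" for b
    using J[OF i(1)] J[OF i(2)] i(4) by (cases b) (simp_all add: j_def)
  then obtain s where s: "\<And>r. s r \<in> {m. ray_point j m \<in> U (if even r then i else i')}"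
      "\<And>r. s r < s (Suc r)"
    using alternating_sequence[of "\<lambda>b. {m. ray_point j m \<in> U (if b then i else i')}"] by blast
  obtain C where C: "\<And>f. f \<in> AC (ray_set k) \<Longrightarrow> bv_norm (ray_set k) f \<le> 4 \<Longrightarrow> bv_norm (ray_set l) (\<Phi> f) \<le> C"
    using AC_homogeneous_bounded[OF cont scale] by blast
  have "real M \<le> C" for M
  proof -
    have "\<forall>r. \<exists>n. even r \<longrightarrow> ray_point j (s r) \<in> F i n"
      using s(1) by (fastforce simp: U_def split: if_splits)
    then obtain N where N: "\<And>r. even r \<Longrightarrow> ray_point j (s r) \<in> F i (N r)" by metis
    define n where "n = Max (N ` {..M})"
    have alt: "e i n (ray_point j (s r)) = (if even r then 1 else 0)" if "r \<le> M" for r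
    proof (cases "even r")
      case True
      have "N r \<le> n" unfolding n_def using that by (intro Max_ge) auto
      with N[OF True] F_mono[OF i(1)] True show ?thesis by (auto simp: F_def)
    next
      case False
      then obtain m where "e i' m (ray_point j (s r)) = 1"
        using s(1)[of r] by (auto simp: U_def F_def)
      then show ?thesis using e_mult[OF i(1,2), of n "ray_point j (s r)" m] i(3) False by simp
    qed
    have "real M \<le> bv_norm (ray_set l) (e i n)"
    proof (rule ray_alternation_bounded)
      show "e i n \<in> BV (ray_set l)" by (intro AC_BV e_AC i(1))
      show "j < l" using J[OF i(1)] by (simp add: j_def)
    qed (fact s(2) alt)+
    also have "\<dots> \<le> C" unfolding e_def by (intro C AC_ray_head i(1))
    finally show ?thesis .
  qed
  then show False using reals_Archimedean2[of C] by (metis not_le)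
qed

text \<open>The inverse of an isomorphism is multiplicative and homogeneous as well, because products and
multiples of elements of \<open>AC\<close> stay in \<open>AC\<close>; so the bound on the number of rays holds in both
directions.\<close>
lemma AC_isomorphic_ray_set:
  assumes "AC_isomorphic (ray_set k) (ray_set l)"
  shows "k = l"
proof -
  obtain \<Phi> where bij: "bij_betw \<Phi> (AC (ray_set k)) (AC (ray_set l))"
    and scale: "\<And>c f. f \<in> AC (ray_set k) \<Longrightarrow> \<Phi> (\<lambda>z. c * f z) = (\<lambda>z. c * \<Phi> f z)"
    and mult: "\<And>f g. f \<in> AC (ray_set k) \<Longrightarrow> g \<in> AC (ray_set k) \<Longrightarrow>
      \<Phi> (\<lambda>z. f z * g z) = (\<lambda>z. \<Phi> f z * \<Phi> g z)"
    and cont: "continuous_map (AC_topology (ray_set k)) (AC_topology (ray_set l)) \<Phi>"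
      "continuous_map (AC_topology (ray_set l)) (AC_topology (ray_set k)) (inv_into (AC (ray_set k)) \<Phi>)"
    using assms unfolding AC_isomorphic_def AC_isomorphism_def by blast
  define \<Psi> where "\<Psi> = inv_into (AC (ray_set k)) \<Phi>"
  have \<Psi>: "\<Psi> g \<in> AC (ray_set k)" "\<Phi> (\<Psi> g) = g" if "g \<in> AC (ray_set l)" for g
    using that bij by (auto simp: \<Psi>_def bij_betw_def inv_into_into f_inv_into_f)
  have \<Psi>_eq: "\<Psi> g = f" if "f \<in> AC (ray_set k)" "\<Phi> f = g" for f g
    using that bij by (auto simp: \<Psi>_def bij_betw_def)
  have "k \<le> l"
    using bij by (intro AC_embedding_ray_count_le[OF cont(1) _ scale mult]) (auto simp: bij_betw_def)
  moreover have "l \<le> k"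
  proof (rule AC_embedding_ray_count_le)
    show "continuous_map (AC_topology (ray_set l)) (AC_topology (ray_set k)) \<Psi>"
      using cont(2) by (simp add: \<Psi>_def)
    show "inj_on \<Psi> (AC (ray_set l))" by (rule inj_on_inverseI[of _ \<Phi>]) (rule \<Psi>)
    show "\<Psi> (\<lambda>z. c * g z) = (\<lambda>z. c * \<Psi> g z)" if "g \<in> AC (ray_set l)" for c g
      using \<Psi>[OF that] by (intro \<Psi>_eq AC_scale) (simp_all add: scale)
    show "\<Psi> (\<lambda>z. g z * h z) = (\<lambda>z. \<Psi> g z * \<Psi> h z)"
      if "g \<in> AC (ray_set l)" "h \<in> AC (ray_set l)" for g h
      using \<Psi>[OF that(1)] \<Psi>[OF that(2)] by (intro \<Psi>_eq AC_mult) (simp_all add: mult)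
  qed
  ultimately show ?thesis by simp
qed

theorem corollary5p8:
  shows "\<exists>F :: complex set set. infinite F \<and> (\<forall>\<sigma>\<in>F. C_set \<sigma>) \<and>
           (\<forall>\<sigma>\<in>F. \<forall>\<tau>\<in>F. \<sigma> \<noteq> \<tau> \<longrightarrow> \<not> AC_isomorphic \<sigma> \<tau>)"
proof (intro exI conjI)
  show "infinite (ray_set ` {0<..})"
    by (simp add: finite_image_iff[OF inj_on_subset[OF inj_ray_set subset_UNIV]] infinite_Ioi)
  show "\<forall>\<sigma>\<in>ray_set ` {0<..}. C_set \<sigma>"
    using C_set_ray_set by auto
  show "\<forall>\<sigma>\<in>ray_set ` {0<..}. \<forall>\<tau>\<in>ray_set ` {0<..}. \<sigma> \<noteq> \<tau> \<longrightarrow> \<not> AC_isomorphic \<sigma> \<tau>"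
    using AC_isomorphic_ray_set by blast
qed

end
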